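(* Let $F(x)=\sum_{i=1}^n\phi_i(a_i^{\top}x)$ on $\mathbb{R}^d$, where each $\phi_i:\mathbb{R}\to\mathbb{R}$ is convex and $L$-smooth, $F$ is $\mu$-strongly convex, $R=\max_i\|a_i\|_2$ and $\kappa=\lceil LR^2/\mu\rceil$. Instantiating APPA with $\lambda=\mu$ and with the primal oracle obtained from the APCG algorithm (a primal $(c,\lambda)$-oracle with running time $\tilde O(nd\sqrt{\kappa_\lambda}\log c)$) yields an algorithm that, from an initial point $x^{(0)}$ with error $\epsilon_0=F(x^{(0)})-\min F$, computes a point of expected error at most $\epsilon$, i.e. $x$ with $\mathbb{E}F(x)-\min F\le\epsilon$, in running time $$\tilde O\big(nd\sqrt{\kappa}\,\log(\epsilon_0/\epsilon)\big).$$
   Context: $L$-smooth: $\phi(y)\le\phi(x)+\phi'(x)(y-x)+\frac L2(y-x)^2$ for all $x,y$. For $s\in\mathbb{R}^d$, $\lambda>0$, let $f_{s,\lambda}(x)=F(x)+\frac\lambda2\|x-s\|_2^2$, $f^{\mathrm{opt}}_{s,\lambda}=\min_xf_{s,\lambda}(x)$, and $\kappa_\lambda=\lceil LR^2/\lambda\rceil$. A primal $(c,\lambda)$-oracle is an algorithm $\mathcal{P}$ that, given $x\in\mathbb{R}^d$, outputs $\mathcal{P}(x)$ with $\mathbb{E}f_{x,\lambda}(\mathcal{P}(x))-f_{x,\lambda}^{\mathrm{opt}}\le\frac1c[f_{x,\lambda}(x)-f^{\mathrm{opt}}_{x,\lambda}]$. APPA with parameter $\lambda$: given $x^{(0)}$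 and a primal $(\frac{2(\lambda+\mu)}{\mu},\lambda)$-oracle $\mathcal{P}$, iterate $x^{(t)}\leftarrow\mathcal{P}(x^{(t-1)})$ for $t=1,\dots,T$ and output $x^{(T)}$. Computational model: for any $i$ and $x\in\mathbb{R}^d$, evaluating $\phi_i(a_i^\top x)$, computing the gradient of $x\mapsto\phi_i(a_i^\top x-b)$ ($b\in\mathbb{R}$), and minimizing $\phi_i(a_i^\top x)+b\|x-c\|_2^2$ ($b\in\mathbb{R}$, $c\in\mathbb{R}^d$) each take $O(d)$ time. $\tilde O(\cdot)$ hides factors polylogarithmic in $n,L,\mu,\lambda,R$; $\log(\epsilon_0/\epsilon)$ is read as $\max\{1,\log(\epsilon_0/\epsilon)\}$. Known fact about APCG (accelerated proximal coordinate gradient, Lin, Lu and Xiao 2014), taken as given: let $g_{s,\lambda}(y)=\sum_{i=1}^n\phi_i^*(y_i)+\frac1{2\lambda}\|A^\top y\|_2^2-s^\top A^\top y$ on $\mathbb{R}^n$, with $\phi_i^*$ the Fenchel conjugate and $A\in\mathbb{R}^{n\times d}$ the matrix with rows $a_i^\top$; APCG is a randomized algorithm that, given $s\in\mathbb{R}^d$, $y\in\mathbb{R}^n$, outputs $y'$ with $\mathbb{E}g_{s,\lambda}(y')-\min g_{s,\lambda}\le\frac1c[g_{s,\lambda}(y)-\min g_{s,\lambda}]$ in time $\tilde O(nd\sqrt{\kappa_\lambda}\log c)$. The primal oracle is obtained from APCG by mapping the input $x$ to the dual point $\hat y(x)$ with $[\hat y(x)]_i=\phi_i'(a_i^\top x)$,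 running APCG on $g_{x,\lambda}$ (with dual reduction factor $c$ times a suitable polynomial in $n,\kappa_\lambda$), and mapping the result $y'$ back to $x-\frac1\lambda A^\top y'$. *)

theory Defs
  imports
    "HOL-Probability.Probability"
    "HOL-Computational_Algebra.Polynomial"
    "Jordan_Normal_Form.Matrix"
begin

hide_const (open) Finite_Cartesian_Product.row Finite_Cartesian_Product.vec
hide_type (open) Finite_Cartesian_Product.vec

section \<open>Regularized sums of convex losses\<close>

text \<open>
  The constants hidden in the asymptotic bounds must not depend on \<open>n\<close> and \<open>d\<close>, so both
  dimensions are values (the numbers of rows and columns of \<open>data\<close>), not types. Only the
  functions \<open>loss I i\<close> with \<open>i < n\<close> matter.
\<close>

record erm =
  loss :: "nat \<Rightarrow> real \<Rightarrow> real"
  data :: "real mat"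
  smoothness :: real
  strong_convexity :: real

abbreviation num_losses :: "erm \<Rightarrow> nat" where
  "num_losses I \<equiv> dim_row (data I)"

abbreviation feat_dim :: "erm \<Rightarrow> nat" where
  "feat_dim I \<equiv> dim_col (data I)"

definition vnorm :: "real Matrix.vec \<Rightarrow> real" where
  "vnorm v = sqrt (v \<bullet> v)"

definition L_smooth :: "real \<Rightarrow> (real \<Rightarrow> real) \<Rightarrow> bool" where
  "L_smooth L \<phi> \<longleftrightarrow> (\<forall>x. \<phi> differentiable (at x)) \<and>
     (\<forall>x y. \<phi> y \<le> \<phi> x + deriv \<phi> x * (y - x) + L / 2 * (y - x)\<^sup>2)"

definition strongly_convex :: "nat \<Rightarrow> real \<Rightarrow> (real Matrix.vec \<Rightarrow> real) \<Rightarrow> bool" where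
  "strongly_convex d \<mu> f \<longleftrightarrow>
     (\<forall>x\<in>carrier_vec d. \<forall>y\<in>carrier_vec d. \<forall>t\<in>{0..1}.
        f (t \<cdot>\<^sub>v x + (1 - t) \<cdot>\<^sub>v y)
          \<le> t * f x + (1 - t) * f y - \<mu> / 2 * t * (1 - t) * (vnorm (x - y))\<^sup>2)"

definition objective :: "erm \<Rightarrow> real Matrix.vec \<Rightarrow> real" where
  "objective I x = (\<Sum>i<num_losses I. loss I i (Matrix.row (data I) i \<bullet> x))"

definition radius :: "erm \<Rightarrow> real" where
  "radius I = Max ((\<lambda>i. vnorm (Matrix.row (data I) i)) ` {..<num_losses I})"

definition cond_num :: "erm \<Rightarrow> real \<Rightarrow> int" where
  "cond_num I lam = \<lceil>smoothness I * (radius I)\<^sup>2 / lam\<rceil>"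

definition standing :: "erm \<Rightarrow> bool" where
  "standing I \<longleftrightarrow> 0 < num_losses I \<and> 0 < feat_dim I \<and> 0 < strong_convexity I \<and>
     (\<forall>i<num_losses I. convex_on UNIV (loss I i) \<and> L_smooth (smoothness I) (loss I i)) \<and>
     strongly_convex (feat_dim I) (strong_convexity I) (objective I)"

definition prox_objective :: "erm \<Rightarrow> real Matrix.vec \<Rightarrow> real \<Rightarrow> real Matrix.vec \<Rightarrow> real" where
  "prox_objective I s lam x = objective I x + lam / 2 * (vnorm (x - s))\<^sup>2"

text \<open>The regularization parameter \<open>\<lambda>\<close> is written \<open>lam\<close>.
  All minima over \<open>\<real>\<^sup>d\<close> below are attained for instances satisfying \<open>standing\<close>.\<close>

definition min_on :: "nat \<Rightarrow> (real Matrix.vec \<Rightarrow> real) \<Rightarrow> real" where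
  "min_on d f = (INF x\<in>carrier_vec d. f x)"

definition excess :: "erm \<Rightarrow> real Matrix.vec \<Rightarrow> real" where
  "excess I x = objective I x - min_on (feat_dim I) (objective I)"

section \<open>The dual problem\<close>

definition conjugate_fn :: "(real \<Rightarrow> real) \<Rightarrow> real \<Rightarrow> ereal" where
  "conjugate_fn \<phi> u = (SUP x. ereal (u * x - \<phi> x))"

definition dual_objective :: "erm \<Rightarrow> real Matrix.vec \<Rightarrow> real \<Rightarrow> real Matrix.vec \<Rightarrow> ereal" where
  "dual_objective I s lam y =
     (\<Sum>i<num_losses I. conjugate_fn (loss I i) (y $ i)) +
     ereal (1 / (2 * lam) * (vnorm (transpose_mat (data I) *\<^sub>v y))\<^sup>2
            - s \<bullet> (transpose_mat (data I) *\<^sub>v y))"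

text \<open>
  The dual objective takes the value \<open>\<infinity>\<close> outside its domain; its minimum over \<open>\<real>\<^sup>n\<close> is finite
  (and attained) for instances satisfying \<open>standing\<close> and \<open>lam > 0\<close>. Hence the dual gap lives in
  \<open>[0,\<infinity>]\<close>.
\<close>

definition dual_gap :: "erm \<Rightarrow> real Matrix.vec \<Rightarrow> real \<Rightarrow> real Matrix.vec \<Rightarrow> ennreal" where
  "dual_gap I s lam y =
     e2ennreal (dual_objective I s lam y - (INF z\<in>carrier_vec (num_losses I). dual_objective I s lam z))"

definition dual_point :: "erm \<Rightarrow> real Matrix.vec \<Rightarrow> real Matrix.vec" where
  "dual_point I x = Matrix.vec (num_losses I) (\<lambda>i. deriv (loss I i) (Matrix.row (data I) i \<bullet> x))"

definition primal_point :: "erm \<Rightarrow> real \<Rightarrow> real Matrix.vec \<Rightarrow> real Matrix.vec \<Rightarrow> real Matrix.vec" where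
  "primal_point I lam s y = s - (1 / lam) \<cdot>\<^sub>v (transpose_mat (data I) *\<^sub>v y)"

section \<open>Randomized algorithms with running times\<close>

text \<open>
  A run of a randomized algorithm is the joint distribution of its output and its running time.
  Running times add up under sequential composition, and a bound on the running time is a bound
  on every run of positive probability.
\<close>

type_synonym 'a timed = "('a \<times> nat) pmf"

definition ret :: "'a \<Rightarrow> 'a timed" where
  "ret x = return_pmf (x, 0)"

definition charge :: "nat \<Rightarrow> 'a \<Rightarrow> 'a timed" where
  "charge t x = return_pmf (x, t)"

definition seq :: "'a timed \<Rightarrow> ('a \<Rightarrow> 'b timed) \<Rightarrow> 'b timed" where
  "seq m f = bind_pmf m (\<lambda>(x, t). map_pmf (\<lambda>(y, u). (y, t + u)) (f x))"

definition result :: "'a timed \<Rightarrow> 'a pmf" where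
  "result m = map_pmf fst m"

definition runs_within :: "'a timed \<Rightarrow> real \<Rightarrow> bool" where
  "runs_within m b \<longleftrightarrow> (\<forall>(x, t)\<in>set_pmf m. real t \<le> b)"

text \<open>Arguments: instance, index \<open>i\<close>, and the data of the elementary operation. The gradient of
  \<open>x \<mapsto> \<phi>\<^sub>i (a\<^sub>i\<^sup>T x - b)\<close> is \<open>\<phi>\<^sub>i' (a\<^sub>i\<^sup>T x - b) a\<^sub>i\<close>; its computation includes that of the scalar
  factor \<open>\<phi>\<^sub>i' (a\<^sub>i\<^sup>T x - b)\<close>.\<close>

record op_costs =
  eval_cost :: "erm \<Rightarrow> nat \<Rightarrow> real Matrix.vec \<Rightarrow> nat"
  grad_cost :: "erm \<Rightarrow> nat \<Rightarrow> real Matrix.vec \<Rightarrow> real \<Rightarrow> nat"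
  prox_cost :: "erm \<Rightarrow> nat \<Rightarrow> real \<Rightarrow> real Matrix.vec \<Rightarrow> nat"
    \<comment> \<open>minimizing \<open>\<phi>\<^sub>i (a\<^sub>i\<^sup>T x) + b \<parallel>x - c\<parallel>\<^sup>2\<close> over \<open>x\<close>\<close>

definition linear_op_costs :: "op_costs \<Rightarrow> bool" where
  "linear_op_costs M \<longleftrightarrow> (\<exists>K::nat. \<forall>I i x b. standing I \<longrightarrow> i < num_losses I \<longrightarrow> x \<in> carrier_vec (feat_dim I) \<longrightarrow>
     eval_cost M I i x \<le> K * feat_dim I \<and>
     grad_cost M I i x b \<le> K * feat_dim I \<and>
     prox_cost M I i b x \<le> K * feat_dim I)"

text \<open>\<open>X\<close> is \<open>O\<close>-tilde of \<open>Y\<close> iff there are universal constants \<open>C\<close>, \<open>k\<close> with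
  \<open>X \<le> C * Y * log_factor I lam ^ k\<close>. Absolute values make the factor polylogarithmic also in the
  reciprocals of the real parameters.\<close>

definition log_factor :: "erm \<Rightarrow> real \<Rightarrow> real" where
  "log_factor I lam = 1 + ln (real (num_losses I)) + \<bar>ln (smoothness I)\<bar> + \<bar>ln (strong_convexity I)\<bar>
     + \<bar>ln lam\<bar> + \<bar>ln (radius I)\<bar>"

definition log1 :: "real \<Rightarrow> real" where
  "log1 r = max 1 (ln r)"

section \<open>Primal oracles, APCG and APPA\<close>

definition primal_oracle ::
  "erm \<Rightarrow> real \<Rightarrow> real \<Rightarrow> (real Matrix.vec \<Rightarrow> real Matrix.vec timed) \<Rightarrow> bool" where
  "primal_oracle I c lam P \<longleftrightarrow> (\<forall>x\<in>carrier_vec (feat_dim I).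
     (let f = prox_objective I x lam; D = result (P x) in
       set_pmf D \<subseteq> carrier_vec (feat_dim I) \<and>
       integrable (measure_pmf D) f \<and>
       measure_pmf.expectation D f - min_on (feat_dim I) f \<le> 1 / c * (f x - min_on (feat_dim I) f)))"

text \<open>Arguments of a dual solver: instance, \<open>lam\<close>, reduction factor \<open>c\<close>, centre \<open>s\<close>, starting point
  \<open>y\<close>.\<close>

type_synonym dual_solver =
  "erm \<Rightarrow> real \<Rightarrow> real \<Rightarrow> real Matrix.vec \<Rightarrow> real Matrix.vec \<Rightarrow> real Matrix.vec timed"

definition apcg_guarantee :: "dual_solver \<Rightarrow> bool" where
  "apcg_guarantee APCG \<longleftrightarrow> (\<exists>(C::real) (k::nat). \<forall>I lam c s y.
     standing I \<longrightarrow> 0 < lam \<longrightarrow> 1 < c \<longrightarrow> s \<in> carrier_vec (feat_dim I) \<longrightarrow> y \<in> carrier_vec (num_losses I) \<longrightarrow>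
     set_pmf (result (APCG I lam c s y)) \<subseteq> carrier_vec (num_losses I) \<and>
     (\<integral>\<^sup>+ y'. dual_gap I s lam y' \<partial>measure_pmf (result (APCG I lam c s y)))
       \<le> ennreal (1 / c) * dual_gap I s lam y \<and>
     runs_within (APCG I lam c s y)
       (C * (real (num_losses I) * real (feat_dim I) * sqrt (of_int (cond_num I lam)) * log1 c)
          * log_factor I lam ^ k))"

text \<open>The bivariate polynomial \<open>p\<close>, evaluated at \<open>n\<close> and \<open>cond_num I lam\<close>, is the extra factor in the dual
  accuracy. Forming \<open>s - (1 / lam) A\<^sup>T y\<close> takes \<open>2nd + 2d\<close> arithmetic operations.\<close>

definition apcg_oracle ::
  "op_costs \<Rightarrow> dual_solver \<Rightarrow> real poly poly \<Rightarrow> erm \<Rightarrow> real \<Rightarrow> real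
     \<Rightarrow> real Matrix.vec \<Rightarrow> real Matrix.vec timed" where
  "apcg_oracle M APCG p I c lam x =
     seq (charge (\<Sum>i<num_losses I. grad_cost M I i x 0) (dual_point I x)) (\<lambda>y.
     seq (APCG I lam (c * poly (poly p [:real (num_losses I):]) (of_int (cond_num I lam))) x y) (\<lambda>y'.
     charge (2 * num_losses I * feat_dim I + 2 * feat_dim I) (primal_point I lam x y')))"

primrec appa_iterate :: "('a \<Rightarrow> 'a timed) \<Rightarrow> 'a \<Rightarrow> nat \<Rightarrow> 'a timed" where
  "appa_iterate P x 0 = ret x"
| "appa_iterate P x (Suc t) = seq (appa_iterate P x t) P"

text \<open>APPA is parametrized by a family of oracles: \<open>P c lam\<close> is meant to be a primal
  \<open>(c, lam)\<close>-oracle.\<close>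

definition appa ::
  "erm \<Rightarrow> real \<Rightarrow> (real \<Rightarrow> real \<Rightarrow> real Matrix.vec \<Rightarrow> real Matrix.vec timed)
     \<Rightarrow> real Matrix.vec \<Rightarrow> nat \<Rightarrow> real Matrix.vec timed" where
  "appa I lam P x T =
     appa_iterate (P (2 * (lam + strong_convexity I) / strong_convexity I) lam) x T"

end

theory Submission
  imports Defs
begin

text \<open>
  Write \<open>f\<close> for \<open>f\<^bsub>s,\<lambda>\<^esub>\<close>, \<open>g\<close> for \<open>g\<^bsub>s,\<lambda>\<^esub>\<close>, \<open>z(y) = s - A\<^sup>T y / \<lambda>\<close> and \<open>q = n L R\<^sup>2 / \<lambda>\<close>. By the
  Fenchel-Young inequality, \<open>f x + g y \<ge> \<lambda>/2 \<parallel>x - z(y)\<parallel>\<^sup>2\<close>, with equality for the dual point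
  \<open>y\<^sub>i = \<phi>\<^sub>i' (a\<^sub>i\<^sup>T x)\<close>, where \<open>\<nabla>f x = \<lambda> (x - z(y))\<close>. As \<open>f\<close> is \<open>(q + 1) \<lambda>\<close>-smooth, its squared gradient
  is at most \<open>2 (q + 1) \<lambda>\<close> times the primal gap. So there is no duality gap, and passing to the dual
  point multiplies the gap by at most \<open>q\<close>. Conversely, smoothness at a near-minimizer \<open>x\<close> of \<open>f\<close> bounds
  the primal gap of \<open>z(y)\<close> by \<open>2 (q + 1)\<close> times the dual gap of \<open>y\<close>. Since \<open>2 q (q + 1) \<le> 4 n\<^sup>2 \<kappa>\<^sub>\<lambda>\<^sup>2\<close>,
  the extra dual accuracy \<open>4 n\<^sup>2 \<kappa>\<^sub>\<lambda>\<^sup>2\<close> suffices; its logarithm is absorbed by the polylogarithmic factor.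

  For APPA, strong convexity along the segment from \<open>x\<close> to a near-minimizer of \<open>F\<close> gives
  \<open>min f\<^bsub>x,\<lambda>\<^esub> - min F \<le> \<lambda>/(\<lambda> + \<mu>) (F x - min F)\<close>. For \<open>\<lambda> = \<mu>\<close> and \<open>c = 4\<close> one step therefore contracts the
  expected error by \<open>3/4 \<cdot> 1/2 + 1/4 = 5/8\<close>.
\<close>

no_notation inner (infix \<open>\<bullet>\<close> 70)

section \<open>Euclidean norm and inner product of vectors of variable dimension\<close>

lemma vnorm_nonneg [simp]: "0 \<le> vnorm v"
  and vnorm_power2: "(vnorm v)\<^sup>2 = v \<bullet> v"
  by (auto simp: vnorm_def scalar_prod_def intro!: sum_nonneg)

lemma vnorm_add_power2:
  assumes "u \<in> carrier_vec d" "v \<in> carrier_vec d"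
  shows "(vnorm (u + v))\<^sup>2 = (vnorm u)\<^sup>2 + 2 * (u \<bullet> v) + (vnorm v)\<^sup>2"
  using assms comm_scalar_prod[OF assms]
  by (simp add: vnorm_power2 add_scalar_prod_distrib[where n=d] scalar_prod_add_distrib[where n=d])

lemma vnorm_smult_power2: "(vnorm (c \<cdot>\<^sub>v v))\<^sup>2 = c\<^sup>2 * (vnorm v)\<^sup>2"
  unfolding vnorm_power2 by (simp add: power2_eq_square)

lemma vnorm_minus_power2:
  assumes "u \<in> carrier_vec d" "v \<in> carrier_vec d"
  shows "(vnorm (u - v))\<^sup>2 = (vnorm u)\<^sup>2 - 2 * (u \<bullet> v) + (vnorm v)\<^sup>2"
  using assms comm_scalar_prod[OF assms]
  by (simp add: vnorm_power2 minus_scalar_prod_distrib[where n=d] scalar_prod_minus_distrib[where n=d])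

lemma scalar_prod_power2_le:
  assumes "dim_vec u = dim_vec v"
  shows "(u \<bullet> v)\<^sup>2 \<le> (vnorm u)\<^sup>2 * (vnorm v)\<^sup>2"
  using Cauchy_Schwarz_ineq_sum[of "($) u" "($) v" "{0..<dim_vec v}"] assms
  unfolding vnorm_power2 by (simp add: scalar_prod_def power2_eq_square)

text \<open>Expand the squared norm of \<open>u - c v\<close>, which is nonnegative, and divide by
  \<open>2 * c\<close>.\<close>

lemma scalar_prod_le_Young:
  assumes "u \<in> carrier_vec d" "v \<in> carrier_vec d" "0 < c"
  shows "u \<bullet> v \<le> (vnorm u)\<^sup>2 / (2 * c) + c / 2 * (vnorm v)\<^sup>2"
proof -
  have "0 \<le> (vnorm u)\<^sup>2 - 2 * (u \<bullet> (c \<cdot>\<^sub>v v)) + (vnorm (c \<cdot>\<^sub>v v))\<^sup>2"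
    using vnorm_minus_power2[OF assms(1), of "c \<cdot>\<^sub>v v"] assms(2)
    by (metis smult_carrier_vec zero_le_power2)
  then show ?thesis
    using assms unfolding vnorm_smult_power2 scalar_prod_smult_distrib[OF assms(1,2)]
    by (simp add: field_simps power2_eq_square)
qed


section \<open>Duality gaps\<close>

lemma convex_above_tangent:
  fixes \<phi> :: "real \<Rightarrow> real"
  assumes "convex_on UNIV \<phi>" "\<phi> differentiable (at x)"
  shows "\<phi> x + deriv \<phi> x * (y - x) \<le> \<phi> y"
  using convex_on_imp_above_tangent[OF assms(1), of x y "deriv \<phi> x"] assms(2)
  by (simp add: DERIV_deriv_iff_real_differentiable)

lemma conjugate_fn_ge: "ereal (u * x - \<phi> x) \<le> conjugate_fn \<phi> u"
  unfolding conjugate_fn_def by (rule SUP_upper) simp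

text \<open>Equality case of Fenchel-Young: the tangent at \<open>x\<close> lies below the function,
  so the supremum is attained at \<open>x\<close>.\<close>

lemma conjugate_fn_deriv:
  assumes "convex_on UNIV \<phi>" "\<phi> differentiable (at x)"
  shows "conjugate_fn \<phi> (deriv \<phi> x) = ereal (deriv \<phi> x * x - \<phi> x)"
proof (rule antisym)
  have "deriv \<phi> x * y - \<phi> y \<le> deriv \<phi> x * x - \<phi> x" for y
    using convex_above_tangent[OF assms, of y] by (simp add: algebra_simps)
  then show "conjugate_fn \<phi> (deriv \<phi> x) \<le> ereal (deriv \<phi> x * x - \<phi> x)"
    unfolding conjugate_fn_def by (intro SUP_least) simp
qed (rule conjugate_fn_ge)

lemma standing_convex: "standing I \<Longrightarrow> i < num_losses I \<Longrightarrow> convex_on UNIV (loss I i)"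
  and standing_L_smooth: "standing I \<Longrightarrow> i < num_losses I \<Longrightarrow> L_smooth (smoothness I) (loss I i)"
  and standing_differentiable:
    "standing I \<Longrightarrow> i < num_losses I \<Longrightarrow> loss I i differentiable (at t)"
  by (auto simp: standing_def L_smooth_def)

lemma dual_point_carrier [simp]: "dual_point I x \<in> carrier_vec (num_losses I)"
  by (simp add: dual_point_def)

lemma transpose_data_mult_carrier [simp]:
  "transpose_mat (data I) *\<^sub>v y \<in> carrier_vec (feat_dim I)"
  by (metis carrier_vecI dim_mult_mat_vec index_transpose_mat(2))

lemma primal_point_carrier [simp]:
  "primal_point I lam s y \<in> carrier_vec (feat_dim I)"
  unfolding primal_point_def
  by (metis carrier_vec_dim_vec carrier_vecD index_minus_vec(2) index_smult_vec(2) transpose_data_mult_carrier)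

lemma row_data_carrier [simp]: "Matrix.row (data I) i \<in> carrier_vec (feat_dim I)"
  by (simp add: Matrix.row_def)

lemma sum_row_scalar_prod:
  assumes "x \<in> carrier_vec (feat_dim I)" "y \<in> carrier_vec (num_losses I)"
  shows "(\<Sum>i<num_losses I. y $ i * (Matrix.row (data I) i \<bullet> x))
    = (transpose_mat (data I) *\<^sub>v y) \<bullet> x"
  using transpose_vec_mult_scalar[of "data I" "num_losses I" "feat_dim I" x y] assms
  by (simp add: scalar_prod_def[of y] atLeast0LessThan)

text \<open>Completing the square. The right-hand side is the dual objective with each conjugate
  replaced by one of the values of which it is the supremum, so inequality and equality between
  primal and dual can be read off term by term.\<close>

lemma vnorm_primal_point_power2:
  assumes "x \<in> carrier_vec (feat_dim I)" "s \<in> carrier_vec (feat_dim I)"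
    "y \<in> carrier_vec (num_losses I)" "0 < lam"
  defines "w \<equiv> transpose_mat (data I) *\<^sub>v y"
  shows "lam / 2 * (vnorm (x - primal_point I lam s y))\<^sup>2 - prox_objective I s lam x
    = (\<Sum>i<num_losses I. y $ i * (Matrix.row (data I) i \<bullet> x) - loss I i (Matrix.row (data I) i \<bullet> x))
      + (1 / (2 * lam) * (vnorm w)\<^sup>2 - s \<bullet> w)"
proof -
  have w: "w \<in> carrier_vec (feat_dim I)"
    by (simp add: w_def)
  have "x - primal_point I lam s y = (x - s) + (1 / lam) \<cdot>\<^sub>v w"
    using assms(1,2) w by (auto simp: primal_point_def w_def[symmetric])
  moreover have "(vnorm ((x - s) + (1 / lam) \<cdot>\<^sub>v w))\<^sup>2
      = (vnorm (x - s))\<^sup>2 + 2 * ((x - s) \<bullet> ((1 / lam) \<cdot>\<^sub>v w)) + (1 / lam)\<^sup>2 * (vnorm w)\<^sup>2"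
    using vnorm_add_power2[of "x - s" "feat_dim I" "(1 / lam) \<cdot>\<^sub>v w"] assms(1,2) w
    by (simp only: vnorm_smult_power2 minus_carrier_vec smult_carrier_vec)
  moreover have "(x - s) \<bullet> ((1 / lam) \<cdot>\<^sub>v w) = (w \<bullet> x - s \<bullet> w) / lam"
    using assms(1,2) w comm_scalar_prod[OF assms(1) w]
    by (simp add: minus_scalar_prod_distrib[where n="feat_dim I"])
  ultimately show ?thesis
    using sum_row_scalar_prod[OF assms(1,3)] assms(4)
    by (simp add: prox_objective_def objective_def sum_subtractf w_def[symmetric]
        field_simps power2_eq_square)
qed

text \<open>Weak duality with a quadratic surplus. The surplus later bounds the distance from
  \<open>x\<close> to the primal point of \<open>y\<close>.\<close>

lemma dual_objective_ge:
  assumes "x \<in> carrier_vec (feat_dim I)" "s \<in> carrier_vec (feat_dim I)"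
    "y \<in> carrier_vec (num_losses I)" "0 < lam"
  shows "ereal (lam / 2 * (vnorm (x - primal_point I lam s y))\<^sup>2 - prox_objective I s lam x)
    \<le> dual_objective I s lam y"
  unfolding vnorm_primal_point_power2[OF assms] dual_objective_def plus_ereal.simps(1)[symmetric]
    sum_ereal[symmetric]
  by (intro add_right_mono sum_mono conjugate_fn_ge)

lemma dual_objective_dual_point:
  assumes "standing I" "x \<in> carrier_vec (feat_dim I)" "s \<in> carrier_vec (feat_dim I)" "0 < lam"
  shows "dual_objective I s lam (dual_point I x)
    = ereal (lam / 2 * (vnorm (x - primal_point I lam s (dual_point I x)))\<^sup>2 - prox_objective I s lam x)"
  unfolding vnorm_primal_point_power2[OF assms(2,3) dual_point_carrier assms(4)]
    dual_objective_def plus_ereal.simps(1)[symmetric] sum_ereal[symmetric]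
  using assms(1)
  by (intro arg_cong2[where f="(+)"] sum.cong refl)
    (simp add: dual_point_def conjugate_fn_deriv standing_convex standing_differentiable)

section \<open>Smoothness of the objective and of its regularization\<close>

text \<open>At the point 1, the tangent at 0 bounds a loss from below and the smoothness inequality
  bounds it from above; the two bounds differ by half the smoothness constant.\<close>

lemma smoothness_nonneg:
  assumes "standing I"
  shows "0 \<le> smoothness I"
proof -
  have "0 < num_losses I"
    using assms by (simp add: standing_def)
  then have "loss I 0 1 \<le> loss I 0 0 + deriv (loss I 0) 0 + smoothness I / 2"
    using standing_L_smooth[OF assms, of 0] unfolding L_smooth_def
    by (metis (no_types, lifting) diff_zero mult.right_neutral one_power2)
  then show ?thesis
    using convex_above_tangent[OF standing_convex standing_differentiable, OF assms _ assms, of 0 0 1]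
      \<open>0 < num_losses I\<close> by simp
qed

lemma vnorm_row_le_radius: "i < num_losses I \<Longrightarrow> vnorm (Matrix.row (data I) i) \<le> radius I"
  unfolding radius_def by (intro Max_ge) auto

lemma radius_nonneg:
  assumes "standing I"
  shows "0 \<le> radius I"
  using vnorm_row_le_radius[of 0 I] vnorm_nonneg[of "Matrix.row (data I) 0"] assms
  unfolding standing_def by linarith

text \<open>Sum the scalar smoothness inequalities and use Cauchy-Schwarz in each second-order term.
  The gradient at \<open>x\<close> is the transposed data matrix applied to the dual point of
  \<open>x\<close>.\<close>

lemma objective_smooth:
  assumes "standing I" "x \<in> carrier_vec (feat_dim I)" "z \<in> carrier_vec (feat_dim I)"
  shows "objective I z \<le> objective I x + (transpose_mat (data I) *\<^sub>v dual_point I x) \<bullet> (z - x)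
    + real (num_losses I) * (smoothness I * (radius I)\<^sup>2) / 2 * (vnorm (z - x))\<^sup>2"
proof -
  define a where "a i = Matrix.row (data I) i" for i
  define v where "v = z - x"
  have v: "v \<in> carrier_vec (feat_dim I)"
    using assms by (simp add: v_def)
  have "loss I i (a i \<bullet> z) \<le> loss I i (a i \<bullet> x) + dual_point I x $ i * (a i \<bullet> v)
      + smoothness I * (radius I)\<^sup>2 / 2 * (vnorm v)\<^sup>2" if i: "i < num_losses I" for i
  proof -
    have "a i \<bullet> v = a i \<bullet> z - a i \<bullet> x"
      using assms by (simp add: a_def v_def scalar_prod_minus_distrib[where n="feat_dim I"])
    then have "loss I i (a i \<bullet> z) \<le> loss I i (a i \<bullet> x) + dual_point I x $ i * (a i \<bullet> v)
        + smoothness I / 2 * (a i \<bullet> v)\<^sup>2"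
      using standing_L_smooth[OF assms(1) i] i by (simp add: L_smooth_def dual_point_def a_def)
    also have "(a i \<bullet> v)\<^sup>2 \<le> (vnorm (a i))\<^sup>2 * (vnorm v)\<^sup>2"
      using v by (intro scalar_prod_power2_le) (simp add: a_def)
    also have "\<dots> \<le> (radius I)\<^sup>2 * (vnorm v)\<^sup>2"
      using vnorm_row_le_radius[OF i] by (intro mult_right_mono power_mono) (auto simp: a_def)
    finally show ?thesis
      using smoothness_nonneg[OF assms(1)] by (simp add: mult_left_mono mult.assoc)
  qed
  then have "objective I z \<le> (\<Sum>i<num_losses I. loss I i (a i \<bullet> x) + dual_point I x $ i * (a i \<bullet> v)
      + smoothness I * (radius I)\<^sup>2 / 2 * (vnorm v)\<^sup>2)"
    unfolding objective_def a_def[symmetric] by (intro sum_mono) simp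
  then show ?thesis
    using sum_row_scalar_prod[OF v dual_point_carrier, of x]
    by (simp add: sum.distrib objective_def a_def v_def)
qed

text \<open>The gradient of the regularized objective at \<open>x\<close> is \<open>lam\<close>
  times the vector from the primal point of \<open>dual_point I x\<close> to \<open>x\<close>; the
  quadratic term is expanded exactly.\<close>

lemma prox_objective_smooth:
  assumes "standing I" "x \<in> carrier_vec (feat_dim I)" "z \<in> carrier_vec (feat_dim I)"
    "s \<in> carrier_vec (feat_dim I)" "0 < lam"
  shows "prox_objective I s lam z \<le> prox_objective I s lam x
    + lam * ((x - primal_point I lam s (dual_point I x)) \<bullet> (z - x))
    + (real (num_losses I) * (smoothness I * (radius I)\<^sup>2) + lam) / 2 * (vnorm (z - x))\<^sup>2"
proof -
  define w where "w = transpose_mat (data I) *\<^sub>v dual_point I x"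
  define v where "v = z - x"
  have w: "w \<in> carrier_vec (feat_dim I)" and v: "v \<in> carrier_vec (feat_dim I)"
    using assms by (auto simp: w_def v_def)
  have "x - primal_point I lam s (dual_point I x) = (x - s) + (1 / lam) \<cdot>\<^sub>v w"
    using assms w by (auto simp: primal_point_def w_def[symmetric])
  then have "lam * ((x - primal_point I lam s (dual_point I x)) \<bullet> v) = lam * ((x - s) \<bullet> v) + w \<bullet> v"
    using assms w v by (simp add: add_scalar_prod_distrib[where n="feat_dim I"] algebra_simps)
  moreover have "z - s = (x - s) + v"
    using assms by (auto simp: v_def)
  then have "(vnorm (z - s))\<^sup>2 = (vnorm (x - s))\<^sup>2 + 2 * ((x - s) \<bullet> v) + (vnorm v)\<^sup>2"
    using vnorm_add_power2[of "x - s" "feat_dim I" v] assms v by simp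
  moreover have "objective I z \<le> objective I x + w \<bullet> v
    + real (num_losses I) * (smoothness I * (radius I)\<^sup>2) / 2 * (vnorm v)\<^sup>2"
    using objective_smooth[OF assms(1-3)] by (simp add: w_def v_def)
  ultimately show ?thesis
    by (simp add: prox_objective_def v_def[symmetric] algebra_simps add_divide_distrib)
qed


section \<open>Lower bounds, near-minimizers and the size of the parameters\<close>

lemma min_on_le:
  "bdd_below (f ` carrier_vec d) \<Longrightarrow> x \<in> carrier_vec d \<Longrightarrow> min_on d f \<le> f x"
  unfolding min_on_def by (rule cINF_lower)

lemma le_min_on: "(\<And>x. x \<in> carrier_vec d \<Longrightarrow> b \<le> f x) \<Longrightarrow> b \<le> min_on d f"
  unfolding min_on_def by (rule cINF_greatest) (use zero_carrier_vec in blast)+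

text \<open>\<open>min_on\<close> is an infimum; the duality arguments below work with
  near-minimizers in place of minimizers.\<close>

lemma min_on_approx:
  assumes "bdd_below (f ` carrier_vec d)" "0 < e"
  obtains x where "x \<in> carrier_vec d" "f x < min_on d f + e"
  using le_min_on[of d "min_on d f + e" f] assms(2) by force

text \<open>By weak duality, the negative of any finite dual value is a lower bound, and the dual
  value at the dual point of 0 is finite.\<close>

lemma bdd_below_prox_objective:
  assumes "standing I" "s \<in> carrier_vec (feat_dim I)" "0 < lam"
  shows "bdd_below (prox_objective I s lam ` carrier_vec (feat_dim I))"
proof -
  define y where "y = dual_point I (0\<^sub>v (feat_dim I))"
  obtain r where r: "dual_objective I s lam y = ereal r"
    using dual_objective_dual_point[OF assms(1) zero_carrier_vec assms(2,3)] by (auto simp: y_def)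
  have "- r \<le> prox_objective I s lam x" if "x \<in> carrier_vec (feat_dim I)" for x
  proof -
    have "lam / 2 * (vnorm (x - primal_point I lam s y))\<^sup>2 - prox_objective I s lam x \<le> r"
      using dual_objective_ge[OF that assms(2) _ assms(3), of y] r by (simp add: y_def)
    moreover have "0 \<le> lam / 2 * (vnorm (x - primal_point I lam s y))\<^sup>2"
      using assms(3) by simp
    ultimately show ?thesis by linarith
  qed
  then show ?thesis
    by (intro bdd_belowI[of _ "- r"]) auto
qed

lemma strongly_convex_midpoint:
  assumes "strongly_convex d \<mu> f" "x \<in> carrier_vec d"
  shows "f ((1 / 2) \<cdot>\<^sub>v x) \<le> (f x + f (0\<^sub>v d)) / 2 - \<mu> / 8 * (vnorm x)\<^sup>2"
proof -
  have "f ((1 / 2) \<cdot>\<^sub>v x + (1 - 1 / 2) \<cdot>\<^sub>v 0\<^sub>v d)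
      \<le> 1 / 2 * f x + (1 - 1 / 2) * f (0\<^sub>v d) - \<mu> / 2 * (1 / 2) * (1 - 1 / 2) * (vnorm (x - 0\<^sub>v d))\<^sup>2"
    using bspec[OF bspec[OF bspec[OF assms(1)[unfolded strongly_convex_def] assms(2)]
        zero_carrier_vec], of "1 / 2"] by simp
  moreover have "(1 / 2) \<cdot>\<^sub>v x + (1 - 1 / 2) \<cdot>\<^sub>v 0\<^sub>v d = (1 / 2) \<cdot>\<^sub>v x" "x - 0\<^sub>v d = x"
    using assms(2) by auto
  ultimately show ?thesis by (simp add: field_simps)
qed

text \<open>Regularize with centre 0 and parameter \<mu>. At \<open>x / 2\<close> the regularization
  term is exactly the gain \<mu>/8 times the squared norm of \<open>x\<close> that strong convexity
  gives at the midpoint of \<open>x\<close> and 0, so a bound for the regularized objective carries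
  over.\<close>

lemma bdd_below_objective:
  assumes "standing I"
  shows "bdd_below (objective I ` carrier_vec (feat_dim I))"
proof -
  define d where "d = feat_dim I"
  define \<mu> where "\<mu> = strong_convexity I"
  have \<mu>: "0 < \<mu>" and sc: "strongly_convex d \<mu> (objective I)"
    using assms by (auto simp: standing_def \<mu>_def d_def)
  obtain b where b: "\<And>x. x \<in> carrier_vec d \<Longrightarrow> b \<le> prox_objective I (0\<^sub>v d) \<mu> x"
    using bdd_below_prox_objective[OF assms zero_carrier_vec \<mu>] by (auto simp: bdd_below_def d_def)
  have "2 * b - objective I (0\<^sub>v d) \<le> objective I x" if x: "x \<in> carrier_vec d" for x
  proof -
    have "(1 / 2) \<cdot>\<^sub>v x - 0\<^sub>v d = (1 / 2) \<cdot>\<^sub>v x"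
      using x by auto
    then have "b \<le> objective I ((1 / 2) \<cdot>\<^sub>v x) + \<mu> / 8 * (vnorm x)\<^sup>2"
      using b[of "(1 / 2) \<cdot>\<^sub>v x"] x unfolding prox_objective_def by (simp add: vnorm_smult_power2 power_divide)
    with strongly_convex_midpoint[OF sc x] show ?thesis by argo
  qed
  then show ?thesis
    by (intro bdd_belowI[of _ "2 * b - objective I (0\<^sub>v d)"]) (auto simp: d_def)
qed

text \<open>Expand around the midpoint \<open>m\<close> of 0 and a unit vector: in the sum of the
  two smoothness inequalities the linear terms cancel, and comparison with strong convexity remains.
  This is what makes smoothness and radius strictly positive.\<close>

lemma strong_convexity_le:
  assumes "standing I"
  shows "strong_convexity I \<le> real (num_losses I) * (smoothness I * (radius I)\<^sup>2)"
proof -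
  define d where "d = feat_dim I"
  define \<mu> where "\<mu> = strong_convexity I"
  define K where "K = real (num_losses I) * (smoothness I * (radius I)\<^sup>2)"
  define x :: "real Matrix.vec" where "x = unit_vec d 0"
  define m where "m = (1 / 2) \<cdot>\<^sub>v x"
  define w where "w = transpose_mat (data I) *\<^sub>v dual_point I m"
  have sc: "strongly_convex d \<mu> (objective I)" and d: "0 < d"
    using assms by (auto simp: standing_def \<mu>_def d_def)
  have x: "x \<in> carrier_vec d" and m: "m \<in> carrier_vec d" and w: "w \<in> carrier_vec d"
    by (auto simp: x_def m_def w_def d_def)
  have n: "(vnorm x)\<^sup>2 = 1" "(vnorm m)\<^sup>2 = 1 / 4"
    unfolding m_def vnorm_smult_power2 unfolding vnorm_power2 x_def
    using d by (auto simp: power2_eq_square)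
  have "x - m = m" "0\<^sub>v d - m = - m"
    using x by (auto simp: m_def)
  moreover have "vnorm (- m) = vnorm m"
    using m by (simp add: vnorm_def)
  ultimately have "objective I x \<le> objective I m + w \<bullet> m + K / 8"
    "objective I (0\<^sub>v d) \<le> objective I m - w \<bullet> m + K / 8"
    using objective_smooth[OF assms, of m x] objective_smooth[OF assms, of m "0\<^sub>v d"] x m w n
    by (auto simp: d_def[symmetric] w_def[symmetric] K_def[symmetric])
  then have "\<mu> \<le> K"
    using strongly_convex_midpoint[OF sc x, folded m_def] unfolding n by argo
  then show ?thesis
    by (simp add: K_def \<mu>_def)
qed

section \<open>Comparison of primal and dual gaps\<close>

text \<open>One gradient step decreases an \<open>M\<close>-smooth function by the squared gradient
  norm over \<open>2 * M\<close>, but never below its infimum.\<close>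

lemma prox_gradient_bound:
  fixes I s lam
  defines "f \<equiv> prox_objective I s lam" and "d \<equiv> feat_dim I"
    and "M \<equiv> real (num_losses I) * (smoothness I * (radius I)\<^sup>2) + lam"
  assumes "standing I" "s \<in> carrier_vec d" "0 < lam" "x \<in> carrier_vec d"
  shows "lam\<^sup>2 * (vnorm (x - primal_point I lam s (dual_point I x)))\<^sup>2 \<le> 2 * M * (f x - min_on d f)"
proof -
  define r where "r = x - primal_point I lam s (dual_point I x)"
  \<comment> \<open>A gradient step of length \<open>1 / M\<close>, the gradient being
    \<open>lam\<close> times \<open>r\<close>.\<close>
  define z where "z = x - (lam / M) \<cdot>\<^sub>v r"
  have M: "0 < M"
    using smoothness_nonneg[OF assms(4)] assms(6) by (simp add: M_def add_nonneg_pos)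
  have r: "r \<in> carrier_vec d"
    using assms(7) primal_point_carrier by (simp add: r_def d_def)
  have z: "z \<in> carrier_vec d"
    using assms(7) r by (simp add: z_def)
  have zx: "z - x = (- (lam / M)) \<cdot>\<^sub>v r"
    using assms(7) r by (auto simp: z_def)
  have "min_on d f \<le> f z"
    unfolding f_def d_def using assms z by (intro min_on_le bdd_below_prox_objective) (auto simp: d_def)
  also have "f z \<le> f x + lam * (r \<bullet> (z - x)) + M / 2 * (vnorm (z - x))\<^sup>2"
    using prox_objective_smooth[of I x z s lam] assms z by (simp add: r_def d_def)
  also have "r \<bullet> (z - x) = - (lam / M) * (vnorm r)\<^sup>2"
    unfolding zx vnorm_power2 using r by simp
  also have "(vnorm (z - x))\<^sup>2 = (lam / M)\<^sup>2 * (vnorm r)\<^sup>2"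
    unfolding zx vnorm_smult_power2 by simp
  also have "f x + lam * (- (lam / M) * (vnorm r)\<^sup>2) + M / 2 * ((lam / M)\<^sup>2 * (vnorm r)\<^sup>2)
      = f x - lam\<^sup>2 * (vnorm r)\<^sup>2 / (2 * M)"
    using M by (simp add: field_simps power2_eq_square)
  finally have "lam\<^sup>2 * (vnorm r)\<^sup>2 / (2 * M) \<le> f x - min_on d f" by simp
  then show ?thesis
    using M by (simp add: r_def field_simps)
qed

text \<open>The gradient bound makes the surplus at the dual point at most \<open>q + 1\<close>
  primal gaps; the summand \<open>- f x\<close> of the dual value uses up one of them.\<close>

lemma dual_objective_dual_point_le:
  fixes I s lam
  defines "f \<equiv> prox_objective I s lam" and "d \<equiv> feat_dim I"
    and "q \<equiv> real (num_losses I) * (smoothness I * (radius I)\<^sup>2) / lam"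
  assumes "standing I" "s \<in> carrier_vec d" "0 < lam" "x \<in> carrier_vec d"
  shows "dual_objective I s lam (dual_point I x) \<le> ereal (- min_on d f + q * (f x - min_on d f))"
proof -
  define N where "N = (vnorm (x - primal_point I lam s (dual_point I x)))\<^sup>2"
  have "lam\<^sup>2 * N \<le> 2 * (real (num_losses I) * (smoothness I * (radius I)\<^sup>2) + lam) * (f x - min_on d f)"
    using prox_gradient_bound[of I s lam x] assms by (simp add: N_def)
  then have "lam / 2 * N \<le> (q + 1) * (f x - min_on d f)"
    using assms(6) by (simp add: q_def field_simps power2_eq_square)
  then show ?thesis
    using dual_objective_dual_point[of I x s lam] assms by (simp add: N_def algebra_simps)
qed

text \<open>Strong duality: dual points of near-minimizers give one inequality, weak duality without
  its surplus the other.\<close>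

lemma min_dual_objective:
  fixes I s lam
  defines "d \<equiv> feat_dim I"
  assumes "standing I" "s \<in> carrier_vec d" "0 < lam"
  shows "(INF y\<in>carrier_vec (num_losses I). dual_objective I s lam y)
    = ereal (- min_on d (prox_objective I s lam))"
proof (rule antisym)
  define f where "f = prox_objective I s lam"
  define q where "q = real (num_losses I) * (smoothness I * (radius I)\<^sup>2) / lam"
  have q: "0 \<le> q"
    using smoothness_nonneg[OF assms(2)] assms(4) by (simp add: q_def)
  show "(INF y\<in>carrier_vec (num_losses I). dual_objective I s lam y) \<le> ereal (- min_on d (prox_objective I s lam))"
  proof (rule ereal_le_epsilon2)
    fix e :: real
    assume "0 < e"
    \<comment> \<open>Passing to the dual point multiplies the primal error by \<open>q\<close>, so
      this accuracy keeps the dual error below \<open>e\<close>.\<close>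
    then have "0 < e / (q + 1)"
      using q by simp
    then obtain x where x: "x \<in> carrier_vec d" "f x < min_on d f + e / (q + 1)"
      using min_on_approx[OF bdd_below_prox_objective[of I s lam], of "e / (q + 1)"] assms
      by (auto simp: f_def)
    have "(INF y\<in>carrier_vec (num_losses I). dual_objective I s lam y) \<le> dual_objective I s lam (dual_point I x)"
      by (rule INF_lower) simp
    also have "\<dots> \<le> ereal (- min_on d f + q * (f x - min_on d f))"
      using dual_objective_dual_point_le[of I s lam x] assms x by (simp add: f_def q_def)
    also have "q * (f x - min_on d f) \<le> q * (e / (q + 1))"
      using x q by (intro mult_left_mono) auto
    also have "\<dots> \<le> e"
      using q \<open>0 < e\<close> by (simp add: field_simps)
    finally show "(INF y\<in>carrier_vec (num_losses I). dual_objective I s lam y)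
        \<le> ereal (- min_on d (prox_objective I s lam)) + ereal e"
      by (simp add: f_def)
  qed
  show "ereal (- min_on d (prox_objective I s lam)) \<le> (INF y\<in>carrier_vec (num_losses I). dual_objective I s lam y)"
  proof (rule INF_greatest)
    fix y :: "real Matrix.vec" assume y: "y \<in> carrier_vec (num_losses I)"
    have *: "ereal (- f x) \<le> dual_objective I s lam y" if "x \<in> carrier_vec d" for x
    proof -
      have "- f x \<le> lam / 2 * (vnorm (x - primal_point I lam s y))\<^sup>2 - f x"
        using assms(4) by simp
      then show ?thesis
        using dual_objective_ge[of x I s y lam] assms that y
        by (metis f_def ereal_less_eq(3) order_trans)
    qed
    show "ereal (- min_on d (prox_objective I s lam)) \<le> dual_objective I s lam y"
    proof (cases "dual_objective I s lam y")
      case (real r)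
      then have "- r \<le> min_on d f"
        using * by (intro le_min_on) (force simp: minus_le_iff)
      then show ?thesis
        using real by (simp add: f_def)
    qed (use *[of "0\<^sub>v d"] in auto)
  qed
qed

lemma dual_gap_eq:
  assumes "standing I" "s \<in> carrier_vec (feat_dim I)" "0 < lam"
  shows "dual_gap I s lam y
    = e2ennreal (dual_objective I s lam y + ereal (min_on (feat_dim I) (prox_objective I s lam)))"
  unfolding dual_gap_def min_dual_objective[OF assms] minus_ereal_def by simp

lemma dual_gap_dual_point_le:
  fixes I s lam
  defines "f \<equiv> prox_objective I s lam" and "d \<equiv> feat_dim I"
    and "q \<equiv> real (num_losses I) * (smoothness I * (radius I)\<^sup>2) / lam"
  assumes "standing I" "s \<in> carrier_vec d" "0 < lam" "x \<in> carrier_vec d"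
  shows "dual_gap I s lam (dual_point I x) \<le> ennreal (q * (f x - min_on d f))"
proof -
  have "dual_objective I s lam (dual_point I x) + ereal (min_on d f)
      \<le> ereal (- min_on d f + q * (f x - min_on d f)) + ereal (min_on d f)"
    using dual_objective_dual_point_le[of I s lam x] assms by (intro add_right_mono) simp
  then show ?thesis
    using assms by (simp add: dual_gap_eq e2ennreal_mono[THEN order_trans])
qed

text \<open>Fix a near-minimizer \<open>x\<close>. The surplus in weak duality bounds its distance
  to the primal point \<open>z\<close>, and smoothness at \<open>x\<close> turns the distance into a
  bound on \<open>f z\<close>; the gradient at \<open>x\<close> is small because \<open>x\<close> is
  nearly optimal.\<close>

lemma excess_primal_point_le:
  fixes I s lam
  defines "f \<equiv> prox_objective I s lam" and "d \<equiv> feat_dim I"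
    and "q \<equiv> real (num_losses I) * (smoothness I * (radius I)\<^sup>2) / lam"
  assumes I: "standing I" and s: "s \<in> carrier_vec d" and lam: "0 < lam"
    and y: "y \<in> carrier_vec (num_losses I)" and r: "dual_objective I s lam y = ereal r"
  shows "f (primal_point I lam s y) - min_on d f \<le> 2 * (q + 1) * (r + min_on d f)"
proof (rule field_le_epsilon)
  define z where "z = primal_point I lam s y"
  define M where "M = real (num_losses I) * (smoothness I * (radius I)\<^sup>2) + lam"
  have q: "0 \<le> q"
    using smoothness_nonneg[OF I] lam by (simp add: q_def)
  have M: "M = (q + 1) * lam"
    using lam by (simp add: M_def q_def field_simps)
  have z: "z \<in> carrier_vec d"
    by (simp add: z_def d_def)
  fix e :: real
  assume "0 < e"
  \<comment> \<open>The error consists of \<open>2 * \<eta>\<close> from the value and the gradient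
    at \<open>x\<close> and of \<open>2 * (q + 1) * \<eta>\<close> from replacing \<open>f x\<close>
    by the infimum in weak duality.\<close>
  define \<eta> where "\<eta> = e / (4 + 2 * q)"
  have \<eta>: "0 < \<eta>" "2 * \<eta> + 2 * (q + 1) * \<eta> = e"
  proof -
    show "0 < \<eta>"
      using q \<open>0 < e\<close> by (simp add: \<eta>_def)
    have "(4 + 2 * q) * \<eta> = e"
      using q by (simp add: \<eta>_def)
    then show "2 * \<eta> + 2 * (q + 1) * \<eta> = e"
      by (simp add: algebra_simps)
  qed
  obtain x where x: "x \<in> carrier_vec d" and fx: "f x < min_on d f + \<eta>"
    using min_on_approx[OF bdd_below_prox_objective[of I s lam] \<eta>(1)] I s lam
    by (auto simp: f_def d_def)
  define g where "g = x - primal_point I lam s (dual_point I x)"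
  define v where "v = z - x"
  have g: "g \<in> carrier_vec d" and v: "v \<in> carrier_vec d"
    using x z primal_point_carrier by (simp_all add: g_def v_def d_def)
  have "lam\<^sup>2 * (vnorm g)\<^sup>2 \<le> 2 * M * (f x - min_on d f)"
    using prox_gradient_bound[of I s lam x] I s lam x by (simp add: M_def f_def d_def g_def)
  then have "lam\<^sup>2 * (vnorm g)\<^sup>2 / (2 * M) \<le> f x - min_on d f"
    using lam q by (simp add: M pos_divide_le_eq mult.commute)
  \<comment> \<open>With weight \<open>q + 1\<close>, multiplication by \<open>lam\<close> gives the
    squared gradient norm over \<open>2 * M\<close> plus a second copy of the smoothness term, as
    \<open>M = (q + 1) * lam\<close>.\<close>
  moreover have "g \<bullet> v \<le> (vnorm g)\<^sup>2 / (2 * (q + 1)) + (q + 1) / 2 * (vnorm v)\<^sup>2"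
    using g v q by (intro scalar_prod_le_Young[of _ d]) auto
  then have "lam * (g \<bullet> v) \<le> lam * ((vnorm g)\<^sup>2 / (2 * (q + 1)) + (q + 1) / 2 * (vnorm v)\<^sup>2)"
    using lam by (intro mult_left_mono) auto
  then have "lam * (g \<bullet> v) \<le> lam\<^sup>2 * (vnorm g)\<^sup>2 / (2 * M) + M / 2 * (vnorm v)\<^sup>2"
  proof -
    have "lam\<^sup>2 * (vnorm g)\<^sup>2 / (2 * M) = lam * ((vnorm g)\<^sup>2 / (2 * (q + 1)))"
      using lam by (simp add: M power2_eq_square[of lam] mult.commute[of "q + 1"]
          mult.left_commute[of 2] mult.assoc del: distrib_left_numeral)
    moreover have "M / 2 * (vnorm v)\<^sup>2 = lam * ((q + 1) / 2 * (vnorm v)\<^sup>2)"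
      by (simp add: M)
    ultimately show ?thesis
      using \<open>lam * (g \<bullet> v) \<le> lam * _\<close> by (simp only: distrib_left)
  qed
  moreover have "f z \<le> f x + lam * (g \<bullet> v) + M / 2 * (vnorm v)\<^sup>2"
    using prox_objective_smooth[of I x z s lam] I s lam x z
    by (simp add: f_def d_def M_def v_def g_def)
  ultimately have "f z - min_on d f \<le> 2 * \<eta> + M * (vnorm v)\<^sup>2"
    using fx by (simp add: algebra_simps)
  moreover have "M * (vnorm v)\<^sup>2 \<le> 2 * (q + 1) * (r + min_on d f + \<eta>)"
  proof -
    have "(vnorm v)\<^sup>2 = (vnorm (x - z))\<^sup>2"
      using vnorm_minus_power2[OF x z] vnorm_minus_power2[OF z x] comm_scalar_prod[OF x z]
      by (simp add: v_def)
    then have "lam / 2 * (vnorm v)\<^sup>2 \<le> r + f x"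
      using dual_objective_ge[of x I s y lam] I s lam x y r by (simp add: f_def d_def z_def)
    then have "lam / 2 * (vnorm v)\<^sup>2 \<le> r + min_on d f + \<eta>"
      using fx by simp
    then have "2 * (q + 1) * (lam / 2 * (vnorm v)\<^sup>2) \<le> 2 * (q + 1) * (r + min_on d f + \<eta>)"
      using q by (intro mult_left_mono) auto
    moreover have "M * (vnorm v)\<^sup>2 = 2 * (q + 1) * (lam / 2 * (vnorm v)\<^sup>2)"
      by (simp add: M)
    ultimately show ?thesis by (simp only:)
  qed
  ultimately show "f (primal_point I lam s y) - min_on d f \<le> 2 * (q + 1) * (r + min_on d f) + e"
    using \<eta>(2) by (simp add: z_def algebra_simps)
qed

text \<open>The form that can be integrated over random dual points. An infinite dual value makes
  the right-hand side infinite, since its factor is positive; weak duality excludes the value minus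
  infinity.\<close>

lemma excess_primal_point_le_dual_gap:
  fixes I s lam
  defines "f \<equiv> prox_objective I s lam" and "d \<equiv> feat_dim I"
    and "q \<equiv> real (num_losses I) * (smoothness I * (radius I)\<^sup>2) / lam"
  assumes "standing I" "s \<in> carrier_vec d" "0 < lam" "y \<in> carrier_vec (num_losses I)"
  shows "ennreal (f (primal_point I lam s y) - min_on d f) \<le> ennreal (2 * (q + 1)) * dual_gap I s lam y"
proof -
  have q: "0 \<le> q"
    using smoothness_nonneg[OF assms(4)] assms(6) by (simp add: q_def)
  have gap: "dual_gap I s lam y = e2ennreal (dual_objective I s lam y + ereal (min_on d f))"
    using dual_gap_eq[of I s lam y] assms by simp
  show ?thesis
  proof (cases "dual_objective I s lam y")
    case (real r)
    then have "ennreal (f (primal_point I lam s y) - min_on d f)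
        \<le> ennreal (2 * (q + 1) * (r + min_on d f))"
      using excess_primal_point_le[of I s lam y r] assms by (intro ennreal_leI) simp
    also have "\<dots> = ennreal (2 * (q + 1)) * ennreal (r + min_on d f)"
      using q by (intro ennreal_mult') simp
    finally show ?thesis
      by (simp add: gap real)
  next
    case PInf
    then show ?thesis
      using q by (simp add: gap ennreal_mult_top)
  next
    case MInf
    then show ?thesis
      using dual_objective_ge[of "0\<^sub>v d" I s y lam] assms by simp
  qed
qed

section \<open>Condition number and logarithmic factors\<close>

lemma
  assumes "standing I" "0 < lam"
  shows smoothness_pos: "0 < smoothness I" and radius_pos: "0 < radius I"
    and cond_num_ge: "smoothness I * (radius I)\<^sup>2 / lam \<le> of_int (cond_num I lam)"
    and cond_num_le: "of_int (cond_num I lam) \<le> smoothness I * (radius I)\<^sup>2 / lam + 1"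
    and cond_num_ge_1: "1 \<le> cond_num I lam"
proof -
  have "0 < real (num_losses I) * (smoothness I * (radius I)\<^sup>2)"
    using strong_convexity_le[OF assms(1)] assms(1) by (simp add: standing_def)
  then have pos: "0 < smoothness I * (radius I)\<^sup>2"
    by (simp add: zero_less_mult_iff)
  then show "0 < smoothness I" "0 < radius I"
    using smoothness_nonneg[OF assms(1)] radius_nonneg[OF assms(1)] by (auto simp: zero_less_mult_iff)
  show "smoothness I * (radius I)\<^sup>2 / lam \<le> of_int (cond_num I lam)"
    "of_int (cond_num I lam) \<le> smoothness I * (radius I)\<^sup>2 / lam + 1"
    unfolding cond_num_def by linarith+
  have "0 < smoothness I * (radius I)\<^sup>2 / lam"
    using pos assms(2) by simp
  then have "0 < cond_num I lam"
    by (simp add: cond_num_def)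
  then show "1 \<le> cond_num I lam" by simp
qed

lemma log1_ge_1: "1 \<le> log1 r"
  by (simp add: log1_def)

lemma log_factor_ge_1: "standing I \<Longrightarrow> 1 \<le> log_factor I lam"
  by (simp add: log_factor_def standing_def)

text \<open>Use \<open>q + 1 \<le> 2 * max 1 q\<close> and \<open>ln 2 < 1\<close>.\<close>

lemma ln_add_1_le:
  fixes q :: real
  assumes "0 < q"
  shows "ln (q + 1) \<le> 1 + \<bar>ln q\<bar>"
proof -
  have "ln (q + 1) \<le> ln (2 * max 1 q)"
    using assms by (intro ln_mono) auto
  also have "\<dots> = ln 2 + ln (max 1 q)"
    using assms by (intro ln_mult_pos) auto
  also have "\<dots> \<le> 1 + \<bar>ln q\<bar>"
    using ln_2_less_1 by (auto simp: max_def)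
  finally show ?thesis .
qed

text \<open>The factor 2 comes from the square of the radius, as \<open>ln (radius I)\<close> enters
  twice, and from the added 1.\<close>

lemma ln_cond_num_le:
  assumes "standing I" "0 < lam"
  shows "ln (of_int (cond_num I lam)) \<le> 2 * log_factor I lam"
proof -
  define q where "q = smoothness I * (radius I)\<^sup>2 / lam"
  have L: "0 < smoothness I" and R: "0 < radius I"
    using smoothness_pos[OF assms] radius_pos[OF assms] by auto
  then have q: "0 < q"
    using assms(2) by (simp add: q_def)
  have "ln (of_int (cond_num I lam)) \<le> ln (q + 1)"
    using cond_num_le[OF assms] cond_num_ge_1[OF assms] by (intro ln_mono) (auto simp: q_def)
  also have "\<dots> \<le> 1 + \<bar>ln q\<bar>"
    using q by (rule ln_add_1_le)
  also have "ln q = ln (smoothness I) + 2 * ln (radius I) - ln lam"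
    using L R assms(2) by (simp add: q_def ln_mult ln_div ln_realpow)
  also have "1 + \<bar>\<dots>\<bar> \<le> 2 * log_factor I lam"
  proof -
    have "0 \<le> ln (real (num_losses I))"
      using assms(1) by (simp add: standing_def)
    then show ?thesis
      unfolding log_factor_def by (smt (verit))
  qed
  finally show ?thesis .
qed

lemma log1_apcg_accuracy_le:
  assumes "standing I" "0 < lam" "1 < c"
  shows "log1 (c * (4 * (of_int (cond_num I lam))\<^sup>2 * (real (num_losses I))\<^sup>2))
    \<le> 9 * (log1 c * log_factor I lam)"
proof -
  define n where "n = real (num_losses I)"
  define \<kappa> where "\<kappa> = real_of_int (cond_num I lam)"
  define l where "l = log_factor I lam"
  have n: "1 \<le> n" and \<kappa>: "1 \<le> \<kappa>" and l: "1 \<le> l"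
    using assms(1) cond_num_ge_1[OF assms(1,2)] log_factor_ge_1
    by (auto simp: n_def \<kappa>_def l_def standing_def)
  have "ln (c * (4 * \<kappa>\<^sup>2 * n\<^sup>2)) = ln c + (ln (2\<^sup>2) + 2 * ln \<kappa> + 2 * ln n)"
    using assms(3) n \<kappa> by (simp add: ln_mult ln_realpow)
  also have "ln (2\<^sup>2 :: real) = 2 * ln 2"
    by (subst ln_realpow) auto
  \<comment> \<open>The three logarithms contribute at most \<open>2 * l\<close>,
    \<open>4 * l\<close> and \<open>2 * l\<close>.\<close>
  also have "ln c + (2 * ln 2 + 2 * ln \<kappa> + 2 * ln n) \<le> ln c + 8 * l"
  proof -
    have "ln n \<le> l"
      by (simp add: n_def l_def log_factor_def)
    then show ?thesis
      using ln_cond_num_le[OF assms(1,2), folded \<kappa>_def l_def] ln_2_less_1 l by linarith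
  qed
  also have "\<dots> \<le> log1 c + 8 * l"
    by (simp add: log1_def)
  finally have "log1 (c * (4 * \<kappa>\<^sup>2 * n\<^sup>2)) \<le> log1 c + 8 * l"
    using l log1_ge_1[of c] unfolding log1_def[of "c * (4 * \<kappa>\<^sup>2 * n\<^sup>2)"] by simp
  also have "\<dots> \<le> log1 c * l + 8 * (log1 c * l)"
    using l log1_ge_1[of c] by (intro add_mono mult_left_mono) (auto simp: mult_le_cancel_left1 mult_le_cancel_right1)
  finally show ?thesis
    by (simp add: n_def \<kappa>_def l_def)
qed

section \<open>Randomized algorithms\<close>

lemma result_ret [simp]: "result (ret x) = return_pmf x"
  and result_charge [simp]: "result (charge t x) = return_pmf x"
  by (simp_all add: result_def ret_def charge_def)

lemma result_seq: "result (seq m f) = bind_pmf (result m) (\<lambda>x. result (f x))"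
  by (simp add: result_def seq_def map_bind_pmf bind_map_pmf pmf.map_comp case_prod_beta o_def)

lemma runs_within_ret: "runs_within (ret x) 0"
  by (simp add: runs_within_def ret_def)

lemma runs_within_charge: "real t \<le> b \<Longrightarrow> runs_within (charge t x) b"
  by (simp add: runs_within_def charge_def)

lemma runs_within_mono: "runs_within m a \<Longrightarrow> a \<le> b \<Longrightarrow> runs_within m b"
  by (fastforce simp: runs_within_def)

lemma runs_within_seq:
  assumes "runs_within m a" "\<And>x. x \<in> set_pmf (result m) \<Longrightarrow> runs_within (f x) b"
  shows "runs_within (seq m f) (a + b)"
proof -
  have "real (t + u) \<le> a + b" if "(x, t) \<in> set_pmf m" "(y, u) \<in> set_pmf (f x)" for x t y u
  proof -
    have "x \<in> set_pmf (result m)"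
      using that(1) by (force simp: result_def)
    then show ?thesis
      using assms that by (fastforce simp: runs_within_def)
  qed
  then show ?thesis
    by (auto simp: runs_within_def seq_def)
qed

lemma set_appa_iterate:
  assumes "\<And>x. x \<in> S \<Longrightarrow> set_pmf (result (P x)) \<subseteq> S" "x \<in> S"
  shows "set_pmf (result (appa_iterate P x T)) \<subseteq> S"
  using assms by (induction T) (auto simp: result_seq)

lemma runs_within_appa_iterate:
  assumes "\<And>x. x \<in> S \<Longrightarrow> set_pmf (result (P x)) \<subseteq> S" "x \<in> S"
    and "\<And>x. x \<in> S \<Longrightarrow> runs_within (P x) b"
  shows "runs_within (appa_iterate P x T) (real T * b)"
proof (induction T)
  case (Suc T)
  have "runs_within (seq (appa_iterate P x T) P) (real T * b + b)"
    using Suc assms(3) set_appa_iterate[of S P x T, OF assms(1,2)] by (intro runs_within_seq) auto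
  then show ?case
    by (simp add: algebra_simps)
qed (simp add: runs_within_ret)

text \<open>Condition on the previous iterate. The contraction is assumed on \<open>S\<close> only,
  and the iterates stay in \<open>S\<close> almost surely. Nonnegative integrals avoid integrability
  conditions for intermediate iterates.\<close>

lemma nn_integral_appa_iterate_le:
  assumes "\<And>x. x \<in> S \<Longrightarrow> set_pmf (result (P x)) \<subseteq> S" "x \<in> S"
    and "\<And>x. x \<in> S \<Longrightarrow> (\<integral>\<^sup>+ y. h y \<partial>measure_pmf (result (P x))) \<le> r * h x"
  shows "(\<integral>\<^sup>+ y. h y \<partial>measure_pmf (result (appa_iterate P x T))) \<le> r ^ T * h x"
proof (induction T)
  case 0
  then show ?case
    by (simp add: nn_integral_return)
next
  case (Suc T)
  have "(\<integral>\<^sup>+ y. h y \<partial>measure_pmf (result (appa_iterate P x (Suc T))))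
      = (\<integral>\<^sup>+ z. \<integral>\<^sup>+ y. h y \<partial>measure_pmf (result (P z)) \<partial>measure_pmf (result (appa_iterate P x T)))"
    by (simp add: result_seq)
  also have "\<dots> \<le> (\<integral>\<^sup>+ z. r * h z \<partial>measure_pmf (result (appa_iterate P x T)))"
    using assms(3) set_appa_iterate[of S P x T, OF assms(1,2)]
    by (intro nn_integral_mono_AE) (auto simp: AE_measure_pmf_iff)
  also have "\<dots> = r * (\<integral>\<^sup>+ z. h z \<partial>measure_pmf (result (appa_iterate P x T)))"
    by (intro nn_integral_cmult) simp
  also have "\<dots> \<le> r * (r ^ T * h x)"
    using Suc by (rule mult_left_mono) simp
  finally show ?case
    by (simp add: mult.assoc)
qed

text \<open>The way back from nonnegative integrals to real expectations: a nonnegative function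
  with finite integral is integrable.\<close>

lemma
  fixes f :: "'a \<Rightarrow> real"
  assumes "\<And>x. x \<in> set_pmf D \<Longrightarrow> m \<le> f x"
    and "(\<integral>\<^sup>+ x. ennreal (f x - m) \<partial>measure_pmf D) \<le> ennreal B" "0 \<le> B"
  shows integrable_pmf_of_nn_integral_le: "integrable (measure_pmf D) f"
    and expectation_pmf_of_nn_integral_le: "measure_pmf.expectation D f - m \<le> B"
proof -
  have AE: "AE x in measure_pmf D. 0 \<le> f x - m"
    using assms(1) by (simp add: AE_measure_pmf_iff)
  have int: "integrable (measure_pmf D) (\<lambda>x. f x - m)"
    using AE assms(2) by (intro integrableI_nonneg) (auto simp: order_le_less_trans)
  then have "integrable (measure_pmf D) (\<lambda>x. (f x - m) + m)"
    by (intro Bochner_Integration.integrable_add) auto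
  then show f: "integrable (measure_pmf D) f"
    by simp
  have "ennreal (measure_pmf.expectation D (\<lambda>x. f x - m)) \<le> ennreal B"
    using assms(2) nn_integral_eq_integral[OF int AE] by simp
  then have "measure_pmf.expectation D (\<lambda>x. f x - m) \<le> B"
    using assms(3) by simp
  then show "measure_pmf.expectation D f - m \<le> B"
    using f by simp
qed

lemma nn_integral_pmf_excess:
  fixes f :: "'a \<Rightarrow> real"
  assumes "\<And>x. x \<in> set_pmf D \<Longrightarrow> m \<le> f x" "integrable (measure_pmf D) f"
  shows "(\<integral>\<^sup>+ x. ennreal (f x - m) \<partial>measure_pmf D) = ennreal (measure_pmf.expectation D f - m)"
  using assms by (subst nn_integral_eq_integral) (auto simp: AE_measure_pmf_iff)

section \<open>The primal oracle\<close>

text \<open>The outer variable stands for the number of losses, the inner one for the condition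
  number.\<close>

definition apcg_accuracy :: "real poly poly" where
  "apcg_accuracy = Polynomial.monom (Polynomial.monom 4 2) 2"

lemma poly_apcg_accuracy: "poly (poly apcg_accuracy [:n:]) k = 4 * k\<^sup>2 * n\<^sup>2"
  by (simp add: apcg_accuracy_def poly_monom power2_eq_square)

lemma result_apcg_oracle:
  "result (apcg_oracle M APCG p I c lam x) = map_pmf (primal_point I lam x)
    (result (APCG I lam (c * poly (poly p [:real (num_losses I):]) (of_int (cond_num I lam))) x (dual_point I x)))"
  by (simp add: apcg_oracle_def result_seq bind_return_pmf map_pmf_def)

text \<open>Three factors multiply: \<open>q\<close> for passing to the dual point,
  \<open>1 / c'\<close> for APCG, \<open>2 * (q + 1)\<close> for mapping back. The polynomial in
  \<open>c'\<close> outweighs the first and the last.\<close>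

lemma primal_oracle_apcg_oracle:
  assumes "apcg_guarantee APCG" "standing I" "1 < c" "0 < lam"
  shows "primal_oracle I c lam (apcg_oracle M APCG apcg_accuracy I c lam)"
  unfolding primal_oracle_def Let_def
proof (intro ballI)
  fix x :: "real Matrix.vec"
  assume x: "x \<in> carrier_vec (feat_dim I)"
  define f where "f = prox_objective I x lam"
  define m where "m = min_on (feat_dim I) f"
  define n where "n = real (num_losses I)"
  define \<kappa> where "\<kappa> = real_of_int (cond_num I lam)"
  define c' where "c' = c * (4 * \<kappa>\<^sup>2 * n\<^sup>2)"
  define q where "q = real (num_losses I) * (smoothness I * (radius I)\<^sup>2) / lam"
  define E where "E = result (APCG I lam c' x (dual_point I x))"
  define D where "D = result (apcg_oracle M APCG apcg_accuracy I c lam x)"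
  have n: "1 \<le> n" and \<kappa>: "1 \<le> \<kappa>"
    using assms(2) cond_num_ge_1[OF assms(2,4)] by (auto simp: n_def \<kappa>_def standing_def)
  have q: "0 \<le> q"
    using smoothness_nonneg[OF assms(2)] assms(4) by (simp add: q_def)
  have "n * (smoothness I * (radius I)\<^sup>2 / lam) \<le> n * \<kappa>"
    using cond_num_ge[OF assms(2,4)] n by (intro mult_left_mono) (auto simp: \<kappa>_def)
  then have q_le: "q \<le> n * \<kappa>"
    by (simp add: q_def n_def)
  have n\<kappa>: "1 \<le> n * \<kappa>"
    using mult_mono[of 1 n 1 \<kappa>] n \<kappa> by simp
  have "1 * 1 \<le> (n * \<kappa>) * (n * \<kappa>)"
    using n\<kappa> by (intro mult_mono) auto
  \<comment> \<open>The APCG guarantee applies only to reduction factors above 1.\<close>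
  then have c': "1 < c'"
    using assms(3) mult_strict_mono'[of 1 c 1 "4 * \<kappa>\<^sup>2 * n\<^sup>2"] by (simp add: c'_def power2_eq_square mult_ac)
  have D: "D = map_pmf (primal_point I lam x) E"
    by (simp add: D_def E_def result_apcg_oracle poly_apcg_accuracy c'_def \<kappa>_def n_def)
  have E: "set_pmf E \<subseteq> carrier_vec (num_losses I)"
    and gap: "(\<integral>\<^sup>+ y. dual_gap I x lam y \<partial>measure_pmf E) \<le> ennreal (1 / c') * dual_gap I x lam (dual_point I x)"
    using assms(1,2,4) c' x dual_point_carrier[of I x] unfolding apcg_guarantee_def E_def by blast+
  have set_D: "set_pmf D \<subseteq> carrier_vec (feat_dim I)"
    by (auto simp: D)
  have m_le: "m \<le> f z" if "z \<in> carrier_vec (feat_dim I)" for z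
    using bdd_below_prox_objective[OF assms(2) x assms(4)] that by (simp add: m_def f_def min_on_le)
  have "(\<integral>\<^sup>+ z. ennreal (f z - m) \<partial>measure_pmf D)
      = (\<integral>\<^sup>+ y. ennreal (f (primal_point I lam x y) - m) \<partial>measure_pmf E)"
    by (simp add: D)
  also have "\<dots> \<le> (\<integral>\<^sup>+ y. ennreal (2 * (q + 1)) * dual_gap I x lam y \<partial>measure_pmf E)"
    using excess_primal_point_le_dual_gap[OF assms(2) x assms(4)] E
    by (intro nn_integral_mono_AE) (auto simp: AE_measure_pmf_iff f_def m_def q_def)
  also have "\<dots> = ennreal (2 * (q + 1)) * (\<integral>\<^sup>+ y. dual_gap I x lam y \<partial>measure_pmf E)"
    by (intro nn_integral_cmult) simp
  also have "\<dots> \<le> ennreal (2 * (q + 1)) * (ennreal (1 / c') * ennreal (q * (f x - m)))"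
    using gap dual_gap_dual_point_le[OF assms(2) x assms(4) x]
    by (intro mult_left_mono order_trans[OF gap]) (auto simp: f_def m_def q_def)
  also have "\<dots> = ennreal (2 * (q + 1)) * ennreal (1 / c' * (q * (f x - m)))"
    using c' by (intro arg_cong2[where f="(*)"] refl ennreal_mult'[symmetric]) simp
  also have "\<dots> = ennreal (2 * (q + 1) * (1 / c' * (q * (f x - m))))"
    using q by (intro ennreal_mult'[symmetric]) simp
  also have "\<dots> \<le> ennreal (1 / c * (f x - m))"
  proof (rule ennreal_leI)
    \<comment> \<open>Both \<open>q\<close> and 1 are at most \<open>n * \<kappa>\<close>, hence
      \<open>q + 1\<close> is at most twice that.\<close>
    have "(q + 1) * q \<le> (2 * (n * \<kappa>)) * (n * \<kappa>)"
      using q q_le n\<kappa> by (intro mult_mono) auto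
    then have "2 * (q + 1) * q \<le> 4 * \<kappa>\<^sup>2 * n\<^sup>2"
      by (simp add: power2_eq_square algebra_simps)
    then have "2 * (q + 1) * q / c' \<le> 4 * \<kappa>\<^sup>2 * n\<^sup>2 / c'"
      using c' by (intro divide_right_mono) auto
    also have "\<dots> = 1 / c"
      using n \<kappa> assms(3) by (simp add: c'_def)
    finally have "2 * (q + 1) * q / c' * (f x - m) \<le> 1 / c * (f x - m)"
      using m_le[OF x] by (intro mult_right_mono) auto
    then show "2 * (q + 1) * (1 / c' * (q * (f x - m))) \<le> 1 / c * (f x - m)"
      by (simp add: mult_ac)
  qed
  finally have "(\<integral>\<^sup>+ z. ennreal (f z - m) \<partial>measure_pmf D) \<le> ennreal (1 / c * (f x - m))" .
  moreover have "0 \<le> 1 / c * (f x - m)"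
    using assms(3) m_le[OF x] by simp
  ultimately have "integrable (measure_pmf D) f" "measure_pmf.expectation D f - m \<le> 1 / c * (f x - m)"
    using integrable_pmf_of_nn_integral_le[of D m f] expectation_pmf_of_nn_integral_le[of D m f]
      set_D m_le by blast+
  then show "set_pmf (result (apcg_oracle M APCG apcg_accuracy I c lam x)) \<subseteq> carrier_vec (feat_dim I) \<and>
      integrable (measure_pmf (result (apcg_oracle M APCG apcg_accuracy I c lam x))) (prox_objective I x lam) \<and>
      measure_pmf.expectation (result (apcg_oracle M APCG apcg_accuracy I c lam x)) (prox_objective I x lam)
        - min_on (feat_dim I) (prox_objective I x lam)
      \<le> 1 / c * (prox_objective I x lam x - min_on (feat_dim I) (prox_objective I x lam))"
    using set_D by (simp add: D_def f_def m_def)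
qed

lemma runs_within_apcg_oracle:
  assumes "linear_op_costs M" "apcg_guarantee APCG"
  obtains C k where "0 \<le> C"
    and "\<And>I c lam x. standing I \<Longrightarrow> 1 < c \<Longrightarrow> 0 < lam \<Longrightarrow> x \<in> carrier_vec (feat_dim I) \<Longrightarrow>
      runs_within (apcg_oracle M APCG apcg_accuracy I c lam x)
        (C * (real (num_losses I) * real (feat_dim I) * sqrt (of_int (cond_num I lam)) * log1 c)
          * log_factor I lam ^ k)"
proof -
  obtain K :: nat where K: "\<And>I i x b. standing I \<Longrightarrow> i < num_losses I \<Longrightarrow> x \<in> carrier_vec (feat_dim I) \<Longrightarrow>
      grad_cost M I i x b \<le> K * feat_dim I"
    using assms(1) unfolding linear_op_costs_def by blast
  obtain C :: real and k where C: "\<And>I lam c s y. standing I \<Longrightarrow> 0 < lam \<Longrightarrow> 1 < c \<Longrightarrow>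
      s \<in> carrier_vec (feat_dim I) \<Longrightarrow> y \<in> carrier_vec (num_losses I) \<Longrightarrow>
      runs_within (APCG I lam c s y)
       (C * (real (num_losses I) * real (feat_dim I) * sqrt (of_int (cond_num I lam)) * log1 c)
          * log_factor I lam ^ k)"
    using assms(2) unfolding apcg_guarantee_def by metis
  \<comment> \<open>The summands pay for the gradients of the dual point, for APCG and for the map
    back to the primal. The absolute value is taken because the APCG constant carries no sign
    condition.\<close>
  define C' where "C' = real K + 9 * \<bar>C\<bar> + 4"
  show thesis
  proof (rule that)
    show "0 \<le> C'"
      by (simp add: C'_def)
    fix I :: erm and c lam :: real and x :: "real Matrix.vec"
    assume I: "standing I" and c: "1 < c" and lam: "0 < lam" and x: "x \<in> carrier_vec (feat_dim I)"
    define n where "n = real (num_losses I)"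
    define d where "d = real (feat_dim I)"
    define \<kappa> where "\<kappa> = real_of_int (cond_num I lam)"
    define l where "l = log_factor I lam"
    define c' where "c' = c * (4 * \<kappa>\<^sup>2 * n\<^sup>2)"
    \<comment> \<open>One logarithmic factor more than in the APCG bound absorbs the logarithm of
      the extra accuracy.\<close>
    define U where "U = n * d * sqrt \<kappa> * log1 c * l ^ Suc k"
    have n: "1 \<le> n" and d: "1 \<le> d" and \<kappa>: "1 \<le> \<kappa>" and l: "1 \<le> l"
      using I cond_num_ge_1[OF I lam] log_factor_ge_1[OF I]
      by (auto simp: n_def d_def \<kappa>_def l_def standing_def)
    have "1 * 1 \<le> \<kappa>\<^sup>2 * n\<^sup>2"
      using n \<kappa> by (intro mult_mono one_le_power) auto
    then have c': "1 < c'"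
      using c mult_strict_mono'[of 1 c 1 "4 * \<kappa>\<^sup>2 * n\<^sup>2"] by (simp add: c'_def)
    have "1 * (1 * 1) \<le> sqrt \<kappa> * (log1 c * l ^ Suc k)"
      using \<kappa> l log1_ge_1[of c] by (intro mult_mono one_le_power) auto
    then have "n * d * 1 \<le> n * d * (sqrt \<kappa> * (log1 c * l ^ Suc k))"
      using n d by (intro mult_left_mono) auto
    then have nd: "n * d \<le> U"
      by (simp add: U_def mult_ac)
    have "(\<Sum>i<num_losses I. grad_cost M I i x 0) \<le> (\<Sum>i<num_losses I. K * feat_dim I)"
      using K[OF I _ x] by (intro sum_mono) simp
    then have "real (\<Sum>i<num_losses I. grad_cost M I i x 0) \<le> real (num_losses I * (K * feat_dim I))"
      by (simp only: of_nat_le_iff) simp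
    also have "\<dots> = real K * (n * d)"
      by (simp add: n_def d_def)
    also have "\<dots> \<le> real K * U"
      using nd by (intro mult_left_mono) auto
    finally have 1: "real (\<Sum>i<num_losses I. grad_cost M I i x 0) \<le> real K * U" .
    have "C * (n * d * sqrt \<kappa> * log1 c') * l ^ k \<le> \<bar>C\<bar> * (n * d * sqrt \<kappa> * log1 c') * l ^ k"
      using n d \<kappa> l log1_ge_1[of c'] by (intro mult_right_mono) auto
    also have "\<dots> \<le> \<bar>C\<bar> * (n * d * sqrt \<kappa> * (9 * (log1 c * l))) * l ^ k"
      using n d \<kappa> l log1_apcg_accuracy_le[OF I lam c]
      by (intro mult_right_mono mult_left_mono) (auto simp: c'_def \<kappa>_def n_def l_def)
    also have "\<dots> = 9 * \<bar>C\<bar> * U"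
      by (simp add: U_def mult_ac)
    finally have 2: "C * (n * d * sqrt \<kappa> * log1 c') * l ^ k \<le> 9 * \<bar>C\<bar> * U" .
    have "1 * d \<le> n * d"
      using n d by (intro mult_right_mono) auto
    then have 3: "real (2 * num_losses I * feat_dim I + 2 * feat_dim I) \<le> 4 * U"
      using nd by (simp add: n_def d_def)
    have "runs_within (apcg_oracle M APCG apcg_accuracy I c lam x) (real K * U + (9 * \<bar>C\<bar> * U + 4 * U))"
      unfolding apcg_oracle_def poly_apcg_accuracy \<kappa>_def[symmetric] n_def[symmetric] c'_def[symmetric]
    proof (intro runs_within_seq runs_within_charge 1 3)
      fix y assume "y \<in> set_pmf (result (charge (\<Sum>i<num_losses I. grad_cost M I i x 0) (dual_point I x)))"
      then have "y \<in> carrier_vec (num_losses I)"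
        by simp
      then show "runs_within (APCG I lam c' x y) (9 * \<bar>C\<bar> * U)"
        using C[OF I lam c' x] 2 by (auto intro: runs_within_mono simp: n_def d_def \<kappa>_def l_def)
    qed
    then show "runs_within (apcg_oracle M APCG apcg_accuracy I c lam x)
        (C' * (real (num_losses I) * real (feat_dim I) * sqrt (of_int (cond_num I lam)) * log1 c)
          * log_factor I lam ^ Suc k)"
      by (simp add: C'_def U_def n_def d_def \<kappa>_def l_def algebra_simps)
  qed
qed

section \<open>Convergence of APPA\<close>

text \<open>Test the regularized minimum on the segment from \<open>x\<close> to an arbitrary
  \<open>z\<close>, and take the infimum over \<open>z\<close> at the end.\<close>

lemma min_prox_objective_le:
  fixes I lam
  defines "F \<equiv> objective I" and "d \<equiv> feat_dim I" and "\<mu> \<equiv> strong_convexity I"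
  assumes "standing I" "0 < lam" "x \<in> carrier_vec d"
  shows "min_on d (prox_objective I x lam) - min_on d F \<le> lam / (lam + \<mu>) * (F x - min_on d F)"
proof -
  \<comment> \<open>At this \<open>t\<close> the regularization term, of order
    \<open>lam * t\<^sup>2\<close>, cancels the strong convexity gain, of order
    \<open>\<mu> * t * (1 - t)\<close>.\<close>
  define t where "t = \<mu> / (lam + \<mu>)"
  have \<mu>: "0 < \<mu>" and sc: "strongly_convex d \<mu> F"
    using assms(4) by (auto simp: standing_def \<mu>_def F_def d_def)
  have t: "0 < t" "t \<le> 1" "1 - t = lam / (lam + \<mu>)"
    using \<mu> assms(5) by (auto simp: t_def field_simps)
  have "(min_on d (prox_objective I x lam) - (1 - t) * F x) / t \<le> F z" if z: "z \<in> carrier_vec d" for z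
  proof -
    define w where "w = t \<cdot>\<^sub>v z + (1 - t) \<cdot>\<^sub>v x"
    have w: "w \<in> carrier_vec d"
      using z assms(6) by (simp add: w_def)
    have "w - x = t \<cdot>\<^sub>v (z - x)"
      using z assms(6) by (intro eq_vecI) (auto simp: w_def algebra_simps)
    then have n: "(vnorm (w - x))\<^sup>2 = t\<^sup>2 * (vnorm (z - x))\<^sup>2"
      by (simp only: vnorm_smult_power2)
    have "min_on d (prox_objective I x lam) \<le> prox_objective I x lam w"
      using bdd_below_prox_objective[of I x lam] assms w by (auto intro: min_on_le)
    also have "\<dots> = F w + lam / 2 * t\<^sup>2 * (vnorm (z - x))\<^sup>2"
      unfolding prox_objective_def n by (simp add: F_def)
    also have "F w \<le> t * F z + (1 - t) * F x - \<mu> / 2 * t * (1 - t) * (vnorm (z - x))\<^sup>2"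
      using bspec[OF bspec[OF bspec[OF sc[unfolded strongly_convex_def] z] assms(6)], of t] t(1,2)
      by (simp add: w_def)
    also have "\<mu> / 2 * t * (1 - t) = t / 2 * (\<mu> * (1 - t))"
      by simp
    also have "\<mu> * (1 - t) = lam * t"
      unfolding t(3) by (simp add: t_def)
    also have "t / 2 * (lam * t) = lam / 2 * t\<^sup>2"
      by (simp add: power2_eq_square)
    finally have "min_on d (prox_objective I x lam) - (1 - t) * F x \<le> F z * t"
      by (simp add: mult.commute)
    then show ?thesis
      using t(1) by (simp add: pos_divide_le_eq)
  qed
  then have "(min_on d (prox_objective I x lam) - (1 - t) * F x) / t \<le> min_on d F"
    by (rule le_min_on)
  then have "min_on d (prox_objective I x lam) - (1 - t) * F x \<le> min_on d F * t"
    using t(1) by (simp add: pos_divide_le_eq)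
  then show ?thesis
    unfolding t(3)[symmetric] by (simp add: algebra_simps)
qed

text \<open>The regularized objective dominates \<open>objective I\<close> and agrees with it at the
  centre \<open>x\<close>. Hence the new error is at most a mixture, with weights
  \<open>1 - 1 / c\<close> and \<open>1 / c\<close>, of the error of the regularized minimum and the
  old error.\<close>

lemma nn_integral_excess_primal_oracle_le:
  assumes "standing I" "0 < lam" "1 \<le> c" "primal_oracle I c lam P" "x \<in> carrier_vec (feat_dim I)"
  shows "(\<integral>\<^sup>+ y. ennreal (excess I y) \<partial>measure_pmf (result (P x)))
    \<le> ennreal ((1 - 1 / c) * (lam / (lam + strong_convexity I)) + 1 / c) * ennreal (excess I x)"
proof -
  define F where "F = objective I"
  define f where "f = prox_objective I x lam"
  define Fm where "Fm = min_on (feat_dim I) F"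
  define fm where "fm = min_on (feat_dim I) f"
  define D where "D = result (P x)"
  define \<rho> where "\<rho> = lam / (lam + strong_convexity I)"
  have D: "set_pmf D \<subseteq> carrier_vec (feat_dim I)" "integrable (measure_pmf D) f"
    "measure_pmf.expectation D f - fm \<le> 1 / c * (f x - fm)"
    using assms(4,5) by (auto simp: primal_oracle_def Let_def D_def f_def fm_def)
  have Ff: "F z \<le> f z" for z
    using assms(2) by (simp add: f_def F_def prox_objective_def)
  have Fm: "Fm \<le> F z" if "z \<in> carrier_vec (feat_dim I)" for z
    using bdd_below_objective[OF assms(1)] that by (simp add: Fm_def F_def min_on_le)
  have "x - x = 0\<^sub>v (feat_dim I)"
    using assms(5) by auto
  then have fx: "f x = F x"
    by (simp add: f_def F_def prox_objective_def vnorm_def)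
  have "0 < strong_convexity I"
    using assms(1) by (simp add: standing_def)
  then have \<rho>: "0 \<le> \<rho>"
    using assms(2) by (simp add: \<rho>_def)
  have "(\<integral>\<^sup>+ y. ennreal (F y - Fm) \<partial>measure_pmf D) \<le> (\<integral>\<^sup>+ y. ennreal (f y - Fm) \<partial>measure_pmf D)"
    using Ff by (intro nn_integral_mono ennreal_leI) simp
  also have "\<dots> = ennreal (measure_pmf.expectation D f - Fm)"
    using D(1,2) Fm Ff by (intro nn_integral_pmf_excess) (blast intro: order_trans)+
  also have "\<dots> \<le> ennreal (((1 - 1 / c) * \<rho> + 1 / c) * (F x - Fm))"
  proof (rule ennreal_leI)
    have "(1 - 1 / c) * (fm - Fm) \<le> (1 - 1 / c) * (\<rho> * (F x - Fm))"
      using min_prox_objective_le[OF assms(1,2,5)] assms(3)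
      by (intro mult_left_mono) (simp_all add: fm_def f_def Fm_def F_def \<rho>_def)
    then show "measure_pmf.expectation D f - Fm \<le> ((1 - 1 / c) * \<rho> + 1 / c) * (F x - Fm)"
      using D(3) unfolding fx by (simp add: algebra_simps diff_divide_distrib)
  qed
  also have "\<dots> = ennreal ((1 - 1 / c) * \<rho> + 1 / c) * ennreal (F x - Fm)"
    using \<rho> assms(3) by (intro ennreal_mult') simp
  finally show ?thesis
    by (simp add: excess_def F_def Fm_def D_def \<rho>_def)
qed

text \<open>The factor \<open>3\<close> is due to \<open>(5/8)\<^sup>3 \<le> 1/e\<close>.\<close>

definition appa_steps :: "real \<Rightarrow> real \<Rightarrow> nat" where
  "appa_steps \<epsilon>0 \<epsilon> = nat \<lceil>3 * log1 (\<epsilon>0 / \<epsilon>)\<rceil>"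

text \<open>Rounding up adds at most 1, and \<open>log1\<close> is at least 1.\<close>

lemma appa_steps_le: "real (appa_steps \<epsilon>0 \<epsilon>) \<le> 4 * log1 (\<epsilon>0 / \<epsilon>)"
  using log1_ge_1[of "\<epsilon>0 / \<epsilon>"] unfolding appa_steps_def by linarith

lemma power_appa_steps_le:
  assumes "0 < \<epsilon>" "0 \<le> \<epsilon>0"
  shows "(5 / 8) ^ appa_steps \<epsilon>0 \<epsilon> * \<epsilon>0 \<le> \<epsilon>"
proof (cases "\<epsilon>0 \<le> \<epsilon>")
  case True
  have "(5 / 8 :: real) ^ appa_steps \<epsilon>0 \<epsilon> \<le> 1"
    by (intro power_le_one) auto
  then have "(5 / 8) ^ appa_steps \<epsilon>0 \<epsilon> * \<epsilon>0 \<le> 1 * \<epsilon>0"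
    using assms(2) by (intro mult_right_mono) auto
  then show ?thesis
    using True by simp
next
  case False
  \<comment> \<open>The cube of 8/5 is 4.096, which exceeds the bound 3 for
    \<open>exp 1\<close>.\<close>
  have "exp (1 / 3 :: real) \<le> 8 / 5"
  proof (rule ccontr)
    assume "\<not> exp (1 / 3 :: real) \<le> 8 / 5"
    then have "(8 / 5) ^ 3 \<le> exp (1 / 3 :: real) ^ 3"
      by (intro power_mono) auto
    also have "\<dots> = exp 1"
      by (simp flip: exp_of_nat_mult)
    finally show False
      using exp_le by (simp add: power3_eq_cube)
  qed
  then have "5 / 8 \<le> exp (- (1 / 3) :: real)"
    using le_imp_inverse_le[of "exp (1 / 3 :: real)" "8 / 5"] by (simp add: exp_minus)
  then have "(5 / 8) ^ appa_steps \<epsilon>0 \<epsilon> \<le> exp (- (1 / 3) :: real) ^ appa_steps \<epsilon>0 \<epsilon>"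
    by (intro power_mono) auto
  also have "\<dots> = exp (- (real (appa_steps \<epsilon>0 \<epsilon>) / 3))"
    by (simp flip: exp_of_nat_mult)
  also have "\<dots> \<le> exp (- ln (\<epsilon>0 / \<epsilon>))"
  proof -
    have "ln (\<epsilon>0 / \<epsilon>) \<le> log1 (\<epsilon>0 / \<epsilon>)"
      by (simp add: log1_def)
    moreover have "3 * log1 (\<epsilon>0 / \<epsilon>) \<le> real (appa_steps \<epsilon>0 \<epsilon>)"
      unfolding appa_steps_def by linarith
    ultimately show ?thesis by simp
  qed
  also have "\<dots> = \<epsilon> / \<epsilon>0"
    using assms(1) False by (simp add: exp_minus)
  finally show ?thesis
    using assms(1) False by (simp add: field_simps)
qed

section \<open>Accuracy and running time of APPA with the APCG oracle\<close>

lemma appa_apcg_oracle_correct: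
  fixes I x0 \<epsilon> M APCG
  defines "D \<equiv> result (appa I (strong_convexity I) (apcg_oracle M APCG apcg_accuracy I) x0
    (appa_steps (excess I x0) \<epsilon>))"
  assumes "apcg_guarantee APCG" "standing I" "x0 \<in> carrier_vec (feat_dim I)" "0 < \<epsilon>"
  shows "set_pmf D \<subseteq> carrier_vec (feat_dim I)"
    and "integrable (measure_pmf D) (objective I)"
    and "measure_pmf.expectation D (objective I) - min_on (feat_dim I) (objective I) \<le> \<epsilon>"
proof -
  define \<mu> where "\<mu> = strong_convexity I"
  define P where "P = apcg_oracle M APCG apcg_accuracy I (2 * (\<mu> + \<mu>) / \<mu>) \<mu>"
  define T where "T = appa_steps (excess I x0) \<epsilon>"
  \<comment> \<open>For \<open>lam = \<mu>\<close> the oracle factor prescribed by APPA is 4 for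
    every instance.\<close>
  have \<mu>: "0 < \<mu>" "2 * (\<mu> + \<mu>) / \<mu> = 4"
    using assms(3) by (auto simp: standing_def \<mu>_def)
  have P: "primal_oracle I 4 \<mu> P"
    unfolding P_def \<mu>(2) using primal_oracle_apcg_oracle[OF assms(2,3) _ \<mu>(1)] by simp
  have D: "D = result (appa_iterate P x0 T)"
    by (simp add: D_def P_def T_def appa_def \<mu>_def)
  have step: "set_pmf (result (P x)) \<subseteq> carrier_vec (feat_dim I)" if "x \<in> carrier_vec (feat_dim I)" for x
    using P that by (auto simp: primal_oracle_def Let_def)
  then show set_D: "set_pmf D \<subseteq> carrier_vec (feat_dim I)"
    unfolding D using assms(4) by (rule set_appa_iterate)
  have ex: "0 \<le> excess I x" if "x \<in> carrier_vec (feat_dim I)" for x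
    using min_on_le[OF bdd_below_objective[OF assms(3)] that] by (simp add: excess_def)
  have "(\<integral>\<^sup>+ y. ennreal (excess I y) \<partial>measure_pmf (result (P x))) \<le> ennreal (5 / 8) * ennreal (excess I x)"
    if "x \<in> carrier_vec (feat_dim I)" for x
  proof -
    have rate: "(1 - 1 / 4) * (\<mu> / (\<mu> + \<mu>)) + 1 / 4 = 5 / 8"
      using \<mu>(1) by simp
    show ?thesis
      using nn_integral_excess_primal_oracle_le[OF assms(3) \<mu>(1) _ P that, folded \<mu>_def]
      unfolding rate by simp
  qed
  then have "(\<integral>\<^sup>+ y. ennreal (excess I y) \<partial>measure_pmf D) \<le> ennreal (5 / 8) ^ T * ennreal (excess I x0)"
    unfolding D using step assms(4) by (intro nn_integral_appa_iterate_le)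
  also have "\<dots> = ennreal ((5 / 8) ^ T * excess I x0)"
    by (simp add: ennreal_power ennreal_mult')
  also have "\<dots> \<le> ennreal \<epsilon>"
    using power_appa_steps_le[OF assms(5) ex[OF assms(4)]] by (intro ennreal_leI) (simp add: T_def)
  finally have *: "(\<integral>\<^sup>+ y. ennreal (objective I y - min_on (feat_dim I) (objective I)) \<partial>measure_pmf D) \<le> ennreal \<epsilon>"
    by (simp add: excess_def)
  have "min_on (feat_dim I) (objective I) \<le> objective I x" if "x \<in> set_pmf D" for x
    using ex set_D that by (auto simp: excess_def)
  note bounds = this * less_imp_le[OF assms(5)]
  show "integrable (measure_pmf D) (objective I)"
    using bounds by (rule integrable_pmf_of_nn_integral_le)
  show "measure_pmf.expectation D (objective I) - min_on (feat_dim I) (objective I) \<le> \<epsilon>"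
    using bounds by (rule expectation_pmf_of_nn_integral_le)
qed

theorem corollary2p6:
  fixes M :: op_costs and APCG :: dual_solver
  assumes "linear_op_costs M"
    and "apcg_guarantee APCG"
  shows "\<exists>p :: real poly poly.
    (\<exists>(C::real) (k::nat). \<forall>I c lam. standing I \<longrightarrow> 1 < c \<longrightarrow> 0 < lam \<longrightarrow>
       primal_oracle I c lam (apcg_oracle M APCG p I c lam) \<and>
       (\<forall>x\<in>carrier_vec (feat_dim I).
          runs_within (apcg_oracle M APCG p I c lam x)
            (C * (real (num_losses I) * real (feat_dim I) * sqrt (of_int (cond_num I lam)) * log1 c)
               * log_factor I lam ^ k))) \<and>
    (\<exists>(T :: real \<Rightarrow> real \<Rightarrow> nat) (C::real) (k::nat). \<forall>I x0 \<epsilon>.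
       standing I \<longrightarrow> x0 \<in> carrier_vec (feat_dim I) \<longrightarrow> 0 < \<epsilon> \<longrightarrow>
       (let \<mu> = strong_convexity I;
            \<epsilon>0 = excess I x0;
            alg = appa I \<mu> (apcg_oracle M APCG p I) x0 (T \<epsilon>0 \<epsilon>);
            D = result alg
        in set_pmf D \<subseteq> carrier_vec (feat_dim I) \<and>
           integrable (measure_pmf D) (objective I) \<and>
           measure_pmf.expectation D (objective I) - min_on (feat_dim I) (objective I) \<le> \<epsilon> \<and>
           runs_within alg
             (C * (real (num_losses I) * real (feat_dim I) * sqrt (of_int (cond_num I \<mu>)) * log1 (\<epsilon>0 / \<epsilon>))
                * log_factor I \<mu> ^ k)))"
proof -
  obtain C k where C: "0 \<le> C"
    and runs: "\<And>I c lam x. standing I \<Longrightarrow> 1 < c \<Longrightarrow> 0 < lam \<Longrightarrow> x \<in> carrier_vec (feat_dim I) \<Longrightarrow>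
      runs_within (apcg_oracle M APCG apcg_accuracy I c lam x)
        (C * (real (num_losses I) * real (feat_dim I) * sqrt (of_int (cond_num I lam)) * log1 c)
          * log_factor I lam ^ k)"
    using runs_within_apcg_oracle[OF assms] by blast
  \<comment> \<open>The number of steps times the cost of one oracle call. The oracle factor is
    always 4, so \<open>log1 4\<close> is a universal constant.\<close>
  have "runs_within (appa I (strong_convexity I) (apcg_oracle M APCG apcg_accuracy I) x0
      (appa_steps (excess I x0) \<epsilon>))
      (4 * C * log1 4 * (real (num_losses I) * real (feat_dim I)
        * sqrt (of_int (cond_num I (strong_convexity I))) * log1 (excess I x0 / \<epsilon>))
        * log_factor I (strong_convexity I) ^ k)"
    if I: "standing I" and x0: "x0 \<in> carrier_vec (feat_dim I)" for I x0 \<epsilon>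
  proof -
    define \<mu> where "\<mu> = strong_convexity I"
    define P where "P = apcg_oracle M APCG apcg_accuracy I (2 * (\<mu> + \<mu>) / \<mu>) \<mu>"
    define B where "B = C * (real (num_losses I) * real (feat_dim I) * sqrt (of_int (cond_num I \<mu>)) * log1 4)
      * log_factor I \<mu> ^ k"
    have \<mu>: "0 < \<mu>" "2 * (\<mu> + \<mu>) / \<mu> = 4"
      using I by (auto simp: standing_def \<mu>_def)
    have "0 \<le> B"
      using C log_factor_ge_1[OF I, of \<mu>] cond_num_ge_1[OF I \<mu>(1)] log1_ge_1[of 4] by (simp add: B_def)
    have "runs_within (P x) B" if "x \<in> carrier_vec (feat_dim I)" for x
      unfolding P_def B_def \<mu>(2) using runs[OF I _ \<mu>(1) that, of 4] by simp
    moreover have "set_pmf (result (P x)) \<subseteq> carrier_vec (feat_dim I)"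
      if "x \<in> carrier_vec (feat_dim I)" for x
      unfolding P_def \<mu>(2) using primal_oracle_apcg_oracle[OF assms(2) I _ \<mu>(1), of 4 M] that
      by (auto simp: primal_oracle_def Let_def)
    ultimately have "runs_within (appa_iterate P x0 (appa_steps (excess I x0) \<epsilon>))
        (real (appa_steps (excess I x0) \<epsilon>) * B)"
      using x0 by (intro runs_within_appa_iterate[of "carrier_vec (feat_dim I)"])
    moreover have "real (appa_steps (excess I x0) \<epsilon>) * B \<le> 4 * log1 (excess I x0 / \<epsilon>) * B"
      using appa_steps_le \<open>0 \<le> B\<close> by (rule mult_right_mono)
    ultimately show ?thesis
      by (auto intro: runs_within_mono simp: appa_def P_def B_def \<mu>_def mult_ac)
  qed
  then show ?thesis
    using primal_oracle_apcg_oracle[OF assms(2)] runs appa_apcg_oracle_correct[OF assms(2)]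
    unfolding Let_def
    by (intro exI[of _ apcg_accuracy] conjI exI[of _ C] exI[of _ k] exI[of _ appa_steps]
        exI[of _ "4 * C * log1 4"]) auto
qed

end
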